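(* Let $A$ be a $\mathbb{Z}$-graded abelian Lie algebra, $\mathcal{Q}$ the quadratic Lie superalgebra and $\mathfrak{g}=A\oplus\mathcal{Q}$. Any finite dimensional simple $\mathfrak{g}$-module is (up to isomorphism) of the form $\Omega_{\lambda,\varrho,\varphi}(V)$, where $\lambda\in\mathfrak{k}_0^*$ is a coradical-finite linear functional, $V=V_{c,\lambda}$ is the corresponding finite dimensional simple $\mathfrak{k}$-module, $\varrho$ is a linear functional on $\mathscr{S}=s^2\mathbb{C}[s^{\pm4}]$, and $\varphi:\mathscr{S}\to\mathrm{End}(V)$ is a linear map taking values in even endomorphisms and satisfying $\varphi(z)(xv)-x\varphi(z)v=[z,x]v$ and $\varphi(z)\varphi(z')v-\varphi(z')\varphi(z)v=0$ for all $x\in\mathfrak{k}$, $z,z'\in\mathscr{S}$, $v\in V$.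
   Context: Ground field $\mathbb{C}$. The quadratic Lie superalgebra is $\mathcal{Q}=\mathcal{Q}_0\oplus\mathcal{Q}_1$, $\mathcal{Q}_0=s^2\mathbb{C}[s^{\pm4}]\oplus t^2\mathbb{C}[t^{\pm4}]$, $\mathcal{Q}_1=t\mathbb{C}[t^{\pm4}]\oplus t^{-1}\mathbb{C}[t^{\pm4}]$ (here $s^{4k+2},t^{4k+2},t^{4k\pm1}$, $k\in\mathbb{Z}$, are basis vectors), with the super-antisymmetric bracket determined, for $k,k'\in\mathbb{Z}$, by $[\mathcal{Q}_0,\mathcal{Q}_0]=[t^2\mathbb{C}[t^{\pm4}],\mathcal{Q}_1]=\{0\}$, $[t^{4k+1},t^{4k'-1}]=0$, $[t^{4k+1},t^{4k'+1}]=t^{4(k+k')+2}$, $[t^{4k-1},t^{4k'-1}]=-t^{4(k+k')-2}$, $[s^{4k-2},t^{4k'+1}]=t^{4(k+k')-1}$, $[s^{4k+2},t^{4k'-1}]=t^{4(k+k')+1}$. $\mathfrak{g}=A\oplus\mathcal{Q}$ is the direct sum of Lie superalgebras ($A$ purely even), and $\mathfrak{k}=A\oplus t^2\mathbb{C}[t^{\pm4}]\oplus t\mathbb{C}[t^{\pm4}]\oplus t^{-1}\mathbb{C}[t^{\pm4}]$, a subalgebra with $\mathfrak{k}_0=A\oplus t^2\mathbb{C}[t^{\pm4}]$, $\mathfrak{k}_1=\mathfrak{g}_1=\mathcal{Q}_1$; thus $\mathfrak{g}=\mathfrak{k}\oplus\mathscr{S}$ with $\mathscr{S}=s^2\mathbb{C}[s^{\pm4}]$.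 Modules are $\mathbb{Z}_2$-graded; a module homomorphism is a $\mathbb{Z}_2$-homogeneous linear map $\psi$ (even or odd) with $\psi(xv)=x\psi(v)$. For $\lambda\in\mathfrak{k}_0^*$, $f_\lambda:\mathfrak{k}_1\times\mathfrak{k}_1\to\mathbb{C}$ is the symmetric bilinear form $f_\lambda(x,y)=\lambda([x,y])$; $\lambda$ is coradical-finite if $\mathfrak{k}_1/\mathrm{rad}(f_\lambda)$ is finite dimensional. For coradical-finite $\lambda$, $V_{c,\lambda}$ denotes the unique (up to isomorphism) finite dimensional simple $\mathfrak{k}$-module on which each $x\in\mathfrak{k}_0$ acts as the scalar $\lambda(x)$; it is the unique finite dimensional simple module over the Clifford superalgebra generated by odd elements $\bar x\in\mathfrak{k}_1/\mathrm{rad}(f_\lambda)$ subject to $\bar x\bar y+\bar y\bar x=f_\lambda(x,y)$. For $\lambda,\varrho,\varphi$ as in the claim, $\Omega_{\lambda,\varrho,\varphi}(V)$ is the superspace $V=V_{c,\lambda}$ with $\mathfrak{g}$-action $x\cdot v=xv$ for $x\in\mathfrak{k}$ and $x\cdot v=\varrho(x)v+\varphi(x)v$ for $x\in\mathscr{S}$. *)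

theory Defs
  imports Complex_Main "HOL-Library.Poly_Mapping" "HOL-Library.Product_Plus" "HOL-Library.Z2"
begin

section \<open>Lie superalgebras over the complex numbers\<close>

text \<open>
  The parity group is the type \<open>bit\<close> of integers modulo 2. A Lie superalgebra lives on the
  subspace \<open>L\<^sub>0 + L\<^sub>1\<close> of an ambient complex vector space (given by a type and a scalar
  multiplication), so that subalgebras are again values of the same record type.
\<close>

record 'g lie_super =
  lscale :: "complex \<Rightarrow> 'g \<Rightarrow> 'g"
  lpart :: "bit \<Rightarrow> 'g set"
  lbracket :: "'g \<Rightarrow> 'g \<Rightarrow> 'g"

definition lcarrier :: "'g::ab_group_add lie_super \<Rightarrow> 'g set" where
  "lcarrier L = {x + y | x y. x \<in> lpart L 0 \<and> y \<in> lpart L 1}"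

definition linear_on ::
  "(complex \<Rightarrow> 'x::ab_group_add \<Rightarrow> 'x) \<Rightarrow> (complex \<Rightarrow> 'y::ab_group_add \<Rightarrow> 'y)
    \<Rightarrow> 'x set \<Rightarrow> ('x \<Rightarrow> 'y) \<Rightarrow> bool" where
  "linear_on s s' W f \<longleftrightarrow>
     (\<forall>x\<in>W. \<forall>y\<in>W. f (x + y) = f x + f y) \<and> (\<forall>c. \<forall>x\<in>W. f (s c x) = s' c (f x))"

definition koszul_sign :: "bit \<Rightarrow> bit \<Rightarrow> complex" where
  "koszul_sign p q = (if p = 1 \<and> q = 1 then -1 else 1)"

definition lie_superalgebra :: "'g::ab_group_add lie_super \<Rightarrow> bool" where
  "lie_superalgebra L \<longleftrightarrow>
     vector_space (lscale L) \<and>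
     (\<forall>p. module.subspace (lscale L) (lpart L p)) \<and>
     lpart L 0 \<inter> lpart L 1 = {0} \<and>
     (\<forall>x\<in>lcarrier L. linear_on (lscale L) (lscale L) (lcarrier L) (lbracket L x)) \<and>
     (\<forall>y\<in>lcarrier L. linear_on (lscale L) (lscale L) (lcarrier L) (\<lambda>x. lbracket L x y)) \<and>
     (\<forall>p q. \<forall>x\<in>lpart L p. \<forall>y\<in>lpart L q. lbracket L x y \<in> lpart L (p + q)) \<and>
     (\<forall>p q. \<forall>x\<in>lpart L p. \<forall>y\<in>lpart L q.
        lbracket L x y = lscale L (- koszul_sign p q) (lbracket L y x)) \<and>
     (\<forall>p q r. \<forall>x\<in>lpart L p. \<forall>y\<in>lpart L q. \<forall>z\<in>lpart L r.
        lbracket L x (lbracket L y z) =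
          lbracket L (lbracket L x y) z
            + lscale L (koszul_sign p q) (lbracket L y (lbracket L x z)))"

definition abelian_lie_algebra :: "'g::ab_group_add lie_super \<Rightarrow> bool" where
  "abelian_lie_algebra L \<longleftrightarrow>
     lie_superalgebra L \<and> lpart L 1 = {0} \<and>
     (\<forall>x\<in>lcarrier L. \<forall>y\<in>lcarrier L. lbracket L x y = 0)"

definition Z_grading :: "'g::ab_group_add lie_super \<Rightarrow> (int \<Rightarrow> 'g set) \<Rightarrow> bool" where
  "Z_grading L D \<longleftrightarrow>
     (\<forall>i. module.subspace (lscale L) (D i) \<and> D i \<subseteq> lcarrier L) \<and>
     (\<forall>x\<in>lcarrier L. \<exists>!f. (\<forall>i. f i \<in> D i) \<and> finite {i. f i \<noteq> 0} \<and>
        x = (\<Sum>i | f i \<noteq> 0. f i)) \<and>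
     (\<forall>i j. \<forall>x\<in>D i. \<forall>y\<in>D j. lbracket L x y \<in> D (i + j))"

definition direct_sum ::
  "'a::ab_group_add lie_super \<Rightarrow> 'b::ab_group_add lie_super \<Rightarrow> ('a \<times> 'b) lie_super" where
  "direct_sum L L' =
     \<lparr>lscale = (\<lambda>c x. (lscale L c (fst x), lscale L' c (snd x))),
      lpart = (\<lambda>p. lpart L p \<times> lpart L' p),
      lbracket = (\<lambda>x y. (lbracket L (fst x) (fst y), lbracket L' (snd x) (snd y)))\<rparr>"


section \<open>Modules\<close>

text \<open>The underlying space of a module is the whole type, \<open>V = V\<^sub>0 \<oplus> V\<^sub>1\<close>.
  Only the action of elements of \<open>lcarrier L\<close> is meaningful.\<close>

record ('g, 'v) super_module =
  mscale :: "complex \<Rightarrow> 'v \<Rightarrow> 'v"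
  mpart :: "bit \<Rightarrow> 'v set"
  mact :: "'g \<Rightarrow> 'v \<Rightarrow> 'v"

definition lie_module ::
  "'g::ab_group_add lie_super \<Rightarrow> ('g, 'v::ab_group_add) super_module \<Rightarrow> bool" where
  "lie_module L M \<longleftrightarrow>
     vector_space (mscale M) \<and>
     (\<forall>p. module.subspace (mscale M) (mpart M p)) \<and>
     mpart M 0 \<inter> mpart M 1 = {0} \<and>
     (\<forall>v. \<exists>v0\<in>mpart M 0. \<exists>v1\<in>mpart M 1. v = v0 + v1) \<and>
     (\<forall>x\<in>lcarrier L. Vector_Spaces.linear (mscale M) (mscale M) (mact M x)) \<and>
     (\<forall>v. linear_on (lscale L) (mscale M) (lcarrier L) (\<lambda>x. mact M x v)) \<and>
     (\<forall>p q. \<forall>x\<in>lpart L p. \<forall>v\<in>mpart M q. mact M x v \<in> mpart M (p + q)) \<and>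
     (\<forall>p q. \<forall>x\<in>lpart L p. \<forall>y\<in>lpart L q. \<forall>v.
        mact M (lbracket L x y) v =
          mact M x (mact M y v) - mscale M (koszul_sign p q) (mact M y (mact M x v)))"

definition finite_dimensional :: "('g, 'v::ab_group_add) super_module \<Rightarrow> bool" where
  "finite_dimensional M \<longleftrightarrow> (\<exists>B. finite B \<and> module.span (mscale M) B = UNIV)"

definition graded_submodule ::
  "'g::ab_group_add lie_super \<Rightarrow> ('g, 'v::ab_group_add) super_module \<Rightarrow> 'v set \<Rightarrow> bool" where
  "graded_submodule L M W \<longleftrightarrow>
     module.subspace (mscale M) W \<and>
     (\<forall>w\<in>W. \<exists>w0\<in>W \<inter> mpart M 0. \<exists>w1\<in>W \<inter> mpart M 1. w = w0 + w1) \<and>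
     (\<forall>x\<in>lcarrier L. \<forall>w\<in>W. mact M x w \<in> W)"

definition simple_module ::
  "'g::ab_group_add lie_super \<Rightarrow> ('g, 'v::ab_group_add) super_module \<Rightarrow> bool" where
  "simple_module L M \<longleftrightarrow>
     lie_module L M \<and> (UNIV :: 'v set) \<noteq> {0} \<and>
     (\<forall>W. graded_submodule L M W \<longrightarrow> W = {0} \<or> W = UNIV)"

definition module_hom ::
  "'g::ab_group_add lie_super \<Rightarrow> ('g, 'v::ab_group_add) super_module
    \<Rightarrow> ('g, 'w::ab_group_add) super_module \<Rightarrow> ('v \<Rightarrow> 'w) \<Rightarrow> bool" where
  "module_hom L M N \<psi> \<longleftrightarrow>
     Vector_Spaces.linear (mscale M) (mscale N) \<psi> \<and>
     (\<exists>d. \<forall>p. \<forall>v\<in>mpart M p. \<psi> v \<in> mpart N (p + d)) \<and>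
     (\<forall>x\<in>lcarrier L. \<forall>v. \<psi> (mact M x v) = mact N x (\<psi> v))"

definition isomorphic_modules ::
  "'g::ab_group_add lie_super \<Rightarrow> ('g, 'v::ab_group_add) super_module
    \<Rightarrow> ('g, 'w::ab_group_add) super_module \<Rightarrow> bool" where
  "isomorphic_modules L M N \<longleftrightarrow> (\<exists>\<psi>. module_hom L M N \<psi> \<and> bij \<psi>)"


section \<open>The quadratic Lie superalgebra\<close>

text \<open>
  \<open>S2 k\<close>, \<open>T2 k\<close>, \<open>T1 k\<close>, \<open>Tm1 k\<close> stand for the basis vectors
  \<open>s\<^bsup>4k+2\<^esup>\<close>, \<open>t\<^bsup>4k+2\<^esup>\<close>, \<open>t\<^bsup>4k+1\<^esup>\<close>, \<open>t\<^bsup>4k-1\<^esup>\<close> respectively.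
\<close>

datatype qbasis = S2 int | T2 int | T1 int | Tm1 int

type_synonym quad = "qbasis \<Rightarrow>\<^sub>0 complex"

definition qscale :: "complex \<Rightarrow> quad \<Rightarrow> quad" where
  "qscale c = Poly_Mapping.map (\<lambda>a. c * a)"

abbreviation qbase :: "qbasis \<Rightarrow> quad" where
  "qbase b \<equiv> Poly_Mapping.single b 1"

definition qspan :: "qbasis set \<Rightarrow> quad set" where
  "qspan B = {x. Poly_Mapping.keys x \<subseteq> B}"

fun qparity :: "qbasis \<Rightarrow> bit" where
  "qparity (S2 k) = 0"
| "qparity (T2 k) = 0"
| "qparity (T1 k) = 1"
| "qparity (Tm1 k) = 1"

text \<open>The exponents are rewritten in the normalised indices: for example
  \<open>[s\<^bsup>4(k+1)-2\<^esup>, t\<^bsup>4k'+1\<^esup>] = t\<^bsup>4(k+1+k')-1\<^esup>\<close> and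
  \<open>[t\<^bsup>4k-1\<^esup>, t\<^bsup>4k'-1\<^esup>] = - t\<^bsup>4(k+k'-1)+2\<^esup>\<close>.\<close>

fun qbracket_basis :: "qbasis \<Rightarrow> qbasis \<Rightarrow> quad" where
  "qbracket_basis (T1 k) (T1 k') = qbase (T2 (k + k'))"
| "qbracket_basis (Tm1 k) (Tm1 k') = - qbase (T2 (k + k' - 1))"
| "qbracket_basis (S2 k) (T1 k') = qbase (Tm1 (k + 1 + k'))"
| "qbracket_basis (T1 k') (S2 k) = - qbase (Tm1 (k + 1 + k'))"
| "qbracket_basis (S2 k) (Tm1 k') = qbase (T1 (k + k'))"
| "qbracket_basis (Tm1 k') (S2 k) = - qbase (T1 (k + k'))"
| "qbracket_basis _ _ = 0"

definition qbracket :: "quad \<Rightarrow> quad \<Rightarrow> quad" where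
  "qbracket x y =
     (\<Sum>i\<in>Poly_Mapping.keys x. \<Sum>j\<in>Poly_Mapping.keys y.
        qscale (Poly_Mapping.lookup x i * Poly_Mapping.lookup y j) (qbracket_basis i j))"

definition quadratic :: "quad lie_super" where
  "quadratic =
     \<lparr>lscale = qscale, lpart = (\<lambda>p. qspan {b. qparity b = p}), lbracket = qbracket\<rparr>"


section \<open>The superalgebra \<open>\<gg>\<close>, its subalgebra \<open>\<kk>\<close>, and the modules \<open>\<Omega>\<close>\<close>

definition g_alg :: "'a::ab_group_add lie_super \<Rightarrow> ('a \<times> quad) lie_super" where
  "g_alg A = direct_sum A quadratic"

definition k_alg :: "'a::ab_group_add lie_super \<Rightarrow> ('a \<times> quad) lie_super" where
  "k_alg A = (g_alg A)
     \<lparr>lpart := (\<lambda>p. lpart A p \<times> qspan {b. b \<notin> range S2 \<and> qparity b = p})\<rparr>"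

definition S_space :: "('a::ab_group_add \<times> quad) set" where
  "S_space = {0} \<times> qspan (range S2)"

definition S_proj :: "'a::ab_group_add \<times> quad \<Rightarrow> 'a \<times> quad" where
  "S_proj x =
     (0, \<Sum>b\<in>Poly_Mapping.keys (snd x) \<inter> range S2.
           Poly_Mapping.single b (Poly_Mapping.lookup (snd x) b))"

definition k_proj :: "'a::ab_group_add \<times> quad \<Rightarrow> 'a \<times> quad" where
  "k_proj x = x - S_proj x"

definition k0_functional ::
  "'a::ab_group_add lie_super \<Rightarrow> ('a \<times> quad \<Rightarrow> complex) \<Rightarrow> bool" where
  "k0_functional A lam \<longleftrightarrow> linear_on (lscale (k_alg A)) (*) (lpart (k_alg A) 0) lam"

definition f_form ::
  "'a::ab_group_add lie_super \<Rightarrow> ('a \<times> quad \<Rightarrow> complex) \<Rightarrow> 'a \<times> quad \<Rightarrow> 'a \<times> quad \<Rightarrow> complex"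
  where "f_form A lam x y = lam (lbracket (k_alg A) x y)"

definition f_rad ::
  "'a::ab_group_add lie_super \<Rightarrow> ('a \<times> quad \<Rightarrow> complex) \<Rightarrow> ('a \<times> quad) set" where
  "f_rad A lam = {x \<in> lpart (k_alg A) 1. \<forall>y\<in>lpart (k_alg A) 1. f_form A lam x y = 0}"

text \<open>Finite dimensionality of the quotient \<open>W / U\<close>: finitely many cosets span it.\<close>

definition finite_dim_quotient ::
  "(complex \<Rightarrow> 'x::ab_group_add \<Rightarrow> 'x) \<Rightarrow> 'x set \<Rightarrow> 'x set \<Rightarrow> bool" where
  "finite_dim_quotient s W U \<longleftrightarrow>
     (\<exists>B. finite B \<and> B \<subseteq> W \<and> (\<forall>x\<in>W. \<exists>b\<in>module.span s B. x - b \<in> U))"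

definition coradical_finite ::
  "'a::ab_group_add lie_super \<Rightarrow> ('a \<times> quad \<Rightarrow> complex) \<Rightarrow> bool" where
  "coradical_finite A lam \<longleftrightarrow>
     finite_dim_quotient (lscale (k_alg A)) (lpart (k_alg A) 1) (f_rad A lam)"

text \<open>The module \<open>V\<^bsub>c,\<lambda>\<^esub>\<close> is determined up to isomorphism only; the predicate holds of
  its representatives.\<close>

definition is_V_c ::
  "'a::ab_group_add lie_super \<Rightarrow> ('a \<times> quad \<Rightarrow> complex)
    \<Rightarrow> ('a \<times> quad, 'v::ab_group_add) super_module \<Rightarrow> bool" where
  "is_V_c A lam V \<longleftrightarrow>
     simple_module (k_alg A) V \<and> finite_dimensional V \<and>
     (\<forall>x\<in>lpart (k_alg A) 0. \<forall>v. mact V x v = mscale V (lam x) v)"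

definition even_linear_family ::
  "'a::ab_group_add lie_super \<Rightarrow> ('a \<times> quad, 'v::ab_group_add) super_module
    \<Rightarrow> ('a \<times> quad \<Rightarrow> 'v \<Rightarrow> 'v) \<Rightarrow> bool" where
  "even_linear_family A V \<phi> \<longleftrightarrow>
     (\<forall>z\<in>S_space. Vector_Spaces.linear (mscale V) (mscale V) (\<phi> z)) \<and>
     (\<forall>v. linear_on (lscale (g_alg A)) (mscale V) S_space (\<lambda>z. \<phi> z v)) \<and>
     (\<forall>z\<in>S_space. \<forall>p. \<forall>v\<in>mpart V p. \<phi> z v \<in> mpart V p)"

text \<open>On \<open>\<kk>\<close> the projections give the action of \<open>V\<close>; on \<open>z \<in> \<S>\<close> they give
  \<open>\<rho>(z) v + \<phi>(z) v\<close>.\<close>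

definition Omega ::
  "('a::ab_group_add \<times> quad \<Rightarrow> complex) \<Rightarrow> ('a \<times> quad \<Rightarrow> 'v \<Rightarrow> 'v)
    \<Rightarrow> ('a \<times> quad, 'v::ab_group_add) super_module \<Rightarrow> ('a \<times> quad, 'v) super_module" where
  "Omega \<rho> \<phi> V = V
     \<lparr>mact := (\<lambda>x v. mact V (k_proj x) v
        + (mscale V (\<rho> (S_proj x)) v + \<phi> (S_proj x) v))\<rparr>"


section \<open>Basic facts\<close>


lemma lookup_qscale [simp]: "Poly_Mapping.lookup (qscale c x) b = c * Poly_Mapping.lookup x b"
  by (simp add: qscale_def Poly_Mapping.map.rep_eq when_def)

lemma vector_space_qscale: "vector_space qscale"
  by unfold_locales (auto intro!: poly_mapping_eqI simp: lookup_add algebra_simps)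

interpretation quad: vector_space qscale by (rule vector_space_qscale)

lemma qbracket_superset:
  assumes "finite I" "finite J" "Poly_Mapping.keys x \<subseteq> I" "Poly_Mapping.keys y \<subseteq> J"
  shows "qbracket x y = (\<Sum>i\<in>I. \<Sum>j\<in>J.
        qscale (Poly_Mapping.lookup x i * Poly_Mapping.lookup y j) (qbracket_basis i j))"
proof -
  have "(\<Sum>j\<in>Poly_Mapping.keys y. qscale (Poly_Mapping.lookup x i * Poly_Mapping.lookup y j) (qbracket_basis i j))
     = (\<Sum>j\<in>J. qscale (Poly_Mapping.lookup x i * Poly_Mapping.lookup y j) (qbracket_basis i j))" for i
    using assms by (intro sum.mono_neutral_left) (auto simp: in_keys_iff)
  then show ?thesis
    unfolding qbracket_def using assms
    by (simp, intro sum.mono_neutral_left) (auto simp: in_keys_iff)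
qed

lemma qbracket_add_left: "qbracket (x + x') y = qbracket x y + qbracket x' y"
proof -
  let ?I = "Poly_Mapping.keys x \<union> Poly_Mapping.keys x'" and ?J = "Poly_Mapping.keys y"
  show ?thesis
    using keys_add[of x x'] 
    by (simp add: qbracket_superset[of ?I ?J] lookup_add distrib_right quad.scale_left_distrib sum.distrib)
qed

lemma qbracket_add_right: "qbracket y (x + x') = qbracket y x + qbracket y x'"
proof -
  let ?J = "Poly_Mapping.keys x \<union> Poly_Mapping.keys x'" and ?I = "Poly_Mapping.keys y"
  show ?thesis
    using keys_add[of x x'] 
    by (simp add: qbracket_superset[of ?I ?J] lookup_add distrib_left quad.scale_left_distrib sum.distrib)
qed

lemma keys_qscale: "Poly_Mapping.keys (qscale c x) \<subseteq> Poly_Mapping.keys x"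
  by (auto simp: in_keys_iff)

lemma qbracket_scale_left: "qbracket (qscale c x) y = qscale c (qbracket x y)"
  using keys_qscale[of c x]
  by (simp add: qbracket_superset[of "Poly_Mapping.keys x" "Poly_Mapping.keys y"] quad.scale_sum_right mult.assoc)

lemma qbracket_scale_right: "qbracket x (qscale c y) = qscale c (qbracket x y)"
  using keys_qscale[of c y]
  by (simp add: qbracket_superset[of "Poly_Mapping.keys x" "Poly_Mapping.keys y"] quad.scale_sum_right mult.left_commute)

lemma qbracket_qbase [simp]: "qbracket (qbase i) (qbase j) = qbracket_basis i j"
  by (simp add: qbracket_def)

lemma qbracket_zero [simp]: "qbracket 0 y = 0" "qbracket y 0 = 0"
  by (simp_all add: qbracket_def)

lemma qbracket_minus [simp]: "qbracket (- x) y = - qbracket x y" "qbracket x (- y) = - qbracket x y"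
  by (metis add.right_inverse add_eq_0_iff qbracket_add_left qbracket_zero(1),
      metis add.right_inverse add_eq_0_iff qbracket_add_right qbracket_zero(2))

lemma qspan_induct [consumes 1, case_names zero base add]:
  assumes "x \<in> qspan B" "P 0" "\<And>c b. b \<in> B \<Longrightarrow> P (qscale c (qbase b))"
    "\<And>x y. P x \<Longrightarrow> P y \<Longrightarrow> P (x + y)"
  shows "P x"
proof -
  have *: "P (\<Sum>b\<in>F. qscale (c b) (qbase b))" if "finite F" "F \<subseteq> B" for F c
    using that by (induction F) (auto intro: assms)
  have "x = (\<Sum>b\<in>Poly_Mapping.keys x. qscale (Poly_Mapping.lookup x b) (qbase b))"
    by (intro poly_mapping_eqI)
       (auto simp: lookup_sum lookup_single when_def in_keys_iff if_distrib[of "\<lambda>a. _ * a"] sum.delta cong: if_cong)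
  with *[of "Poly_Mapping.keys x" "Poly_Mapping.lookup x"] assms(1) show ?thesis
    by (simp add: qspan_def)
qed

lemma subspace_qspan: "module.subspace qscale (qspan B)"
  unfolding quad.subspace_def qspan_def
  by (auto simp: in_keys_iff lookup_add) (metis (mono_tags) add_0 in_keys_iff subsetD)

lemma qbracket_parity:
  assumes "x \<in> qspan {b. qparity b = p}" "y \<in> qspan {b. qparity b = q}"
  shows "qbracket x y \<in> qspan {b. qparity b = p + q}"
  using assms(1)
proof (induction rule: qspan_induct)
  case (base c b)
  show ?case using assms(2)
  proof (induction rule: qspan_induct)
    case zero
    show ?case by (simp add: qspan_def)
  next
    case (base c' b')
    have "qbracket_basis b b' \<in> qspan {b. qparity b = p + q}"
      using base \<open>b \<in> _\<close> by (cases b; cases b') (auto simp: qspan_def)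
    then show ?case
      by (auto simp: qbracket_scale_left qbracket_scale_right
          intro!: quad.subspace_scale subspace_qspan)
  qed (auto simp: qbracket_add_right intro!: quad.subspace_add subspace_qspan)
qed (auto simp: qbracket_add_left intro!: quad.subspace_add quad.subspace_0 subspace_qspan)

lemma qbracket_antisym:
  assumes "x \<in> qspan {b. qparity b = p}" "y \<in> qspan {b. qparity b = q}"
  shows "qbracket x y = qscale (- koszul_sign p q) (qbracket y x)"
  using assms(1)
proof (induction rule: qspan_induct)
  case (base c b)
  show ?case using assms(2)
  proof (induction rule: qspan_induct)
    case (base c' b')
    have "qbracket_basis b b' = qscale (- koszul_sign p q) (qbracket_basis b' b)"
      using base \<open>b \<in> _\<close> by (cases b; cases b') (auto simp: koszul_sign_def add_ac)
    then show ?case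
      by (simp add: qbracket_scale_left qbracket_scale_right mult_ac)
  qed (auto simp: qbracket_add_left qbracket_add_right quad.scale_right_distrib)
qed (auto simp: qbracket_add_left qbracket_add_right quad.scale_right_distrib)

lemma qbracket_jacobi:
  assumes "x \<in> qspan {b. qparity b = p}" "y \<in> qspan {b. qparity b = q}" 
    "z \<in> qspan {b. qparity b = r}"
  shows "qbracket x (qbracket y z) = qbracket (qbracket x y) z
            + qscale (koszul_sign p q) (qbracket y (qbracket x z))"
  using assms(1)
proof (induction rule: qspan_induct)
  case (base c b)
  show ?case using assms(2)
  proof (induction rule: qspan_induct)
    case (base c' b')
    show ?case using assms(3)
    proof (induction rule: qspan_induct)
      case (base c'' b'')
      have "qbracket (qbase b) (qbracket_basis b' b'') = qbracket (qbracket_basis b b') (qbase b'')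
            + qscale (koszul_sign p q) (qbracket (qbase b') (qbracket_basis b b''))"
        using base \<open>b \<in> _\<close> \<open>b' \<in> _\<close>
        by (cases b; cases b'; cases b'') (auto simp: koszul_sign_def algebra_simps)
      then show ?case
        by (simp add: qbracket_scale_left qbracket_scale_right quad.scale_right_distrib mult_ac)
    qed (auto simp: qbracket_add_left qbracket_add_right quad.scale_right_distrib algebra_simps)
  qed (auto simp: qbracket_add_left qbracket_add_right quad.scale_right_distrib algebra_simps)
qed (auto simp: qbracket_add_left qbracket_add_right quad.scale_right_distrib algebra_simps)

lemma lie_superalgebra_quadratic: "lie_superalgebra quadratic"
proof -
  have "qspan {b. qparity b = 0} \<inter> qspan {b. qparity b = 1} = {0}"
    by (fastforce simp: qspan_def intro!: poly_mapping_eqI simp: in_keys_iff)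
  moreover have "linear_on qscale qscale W (qbracket x)" "linear_on qscale qscale W (\<lambda>x. qbracket x y)"
    for W x y
    by (simp_all add: linear_on_def qbracket_add_left qbracket_add_right
        qbracket_scale_left qbracket_scale_right)
  ultimately show ?thesis
    unfolding lie_superalgebra_def quadratic_def lie_super.simps
    by (intro conjI allI ballI vector_space_qscale subspace_qspan qbracket_parity
        qbracket_antisym qbracket_jacobi)
qed

lemma lcarrier_quadratic: "lcarrier quadratic = UNIV"
proof -
  have "x \<in> lcarrier quadratic" if "x \<in> qspan UNIV" for x
    using that
  proof (induction rule: qspan_induct)
    case zero
    show ?case
      unfolding lcarrier_def quadratic_def qspan_def
      by (intro CollectI exI[of _ 0]) simp
  next
    case (base c b)
    have "qscale c (qbase b) \<in> lpart quadratic (qparity b)"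
      by (auto simp: quadratic_def qspan_def in_keys_iff lookup_single when_def split: if_splits)
    moreover have "0 \<in> lpart quadratic p" for p
      by (simp add: quadratic_def qspan_def)
    ultimately show ?case
      unfolding lcarrier_def by (cases "qparity b") (force intro: exI[of _ 0])+
  next
    case (add x y)
    then obtain a b c d where "x = a + b" "y = c + d"
      "a \<in> lpart quadratic 0" "b \<in> lpart quadratic 1" "c \<in> lpart quadratic 0" "d \<in> lpart quadratic 1"
      by (auto simp: lcarrier_def)
    moreover have "a + c \<in> lpart quadratic 0" "b + d \<in> lpart quadratic 1"
      using calculation by (auto simp: quadratic_def intro!: quad.subspace_add subspace_qspan)
    moreover have "x + y = (a + c) + (b + d)"
      using calculation by simp
    ultimately show ?case unfolding lcarrier_def by blast
  qed
  then show ?thesis by (auto simp: qspan_def)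
qed

lemma lie_superalgebraD:
  assumes "lie_superalgebra L"
  shows "vector_space (lscale L)"
    and "module.subspace (lscale L) (lpart L p)"
    and "x \<in> lcarrier L \<Longrightarrow> linear_on (lscale L) (lscale L) (lcarrier L) (lbracket L x)"
    and "x \<in> lcarrier L \<Longrightarrow> linear_on (lscale L) (lscale L) (lcarrier L) (\<lambda>y. lbracket L y x)"
    and "x \<in> lpart L p \<Longrightarrow> y \<in> lpart L q \<Longrightarrow> lbracket L x y \<in> lpart L (p + q)"
    and "x \<in> lpart L p \<Longrightarrow> y \<in> lpart L q \<Longrightarrow>
      lbracket L x y = lscale L (- koszul_sign p q) (lbracket L y x)"
    and "x \<in> lpart L p \<Longrightarrow> y \<in> lpart L q \<Longrightarrow> z \<in> lpart L r \<Longrightarrow>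
      lbracket L x (lbracket L y z) = lbracket L (lbracket L x y) z
        + lscale L (koszul_sign p q) (lbracket L y (lbracket L x z))"
    and "lpart L 0 \<inter> lpart L 1 = {0}"
  using assms unfolding lie_superalgebra_def by blast+

lemma lie_superalgebra_direct_sum:
  assumes "lie_superalgebra L" "lie_superalgebra L'"
  shows "lie_superalgebra (direct_sum L L')"
proof -
  have s: "module.subspace (lscale L) (lpart L p)" "module.subspace (lscale L') (lpart L' p)" for p
    using assms by (auto intro: lie_superalgebraD)
  interpret a: vector_space "lscale L" by (rule lie_superalgebraD) fact
  interpret b: vector_space "lscale L'" by (rule lie_superalgebraD) fact
  interpret c: vector_space "lscale (direct_sum L L')"
    by unfold_locales (auto simp: direct_sum_def algebra_simps a.scale_right_distrib a.scale_left_distrib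
     b.scale_right_distrib b.scale_left_distrib)
  have sub: "c.subspace (lpart (direct_sum L L') p)" for p
    using s[of p] unfolding c.subspace_def a.subspace_def b.subspace_def
    by (auto simp: direct_sum_def zero_prod_def)
  have car: "lcarrier (direct_sum L L') = lcarrier L \<times> lcarrier L'"
    unfolding lcarrier_def direct_sum_def by force
  have zero: "lpart (direct_sum L L') 0 \<inter> lpart (direct_sum L L') 1 = {0}"
    using assms[THEN lie_superalgebraD(8)] by (simp add: direct_sum_def zero_prod_def Times_Int_Times)
  show ?thesis
    unfolding lie_superalgebra_def car
  proof (intro conjI zero sub c.vector_space_axioms allI ballI)
    fix x assume "x \<in> lcarrier L \<times> lcarrier L'"
    then have "linear_on (lscale L) (lscale L) (lcarrier L) (lbracket L (fst x))"
      "linear_on (lscale L) (lscale L) (lcarrier L) (\<lambda>y. lbracket L y (fst x))"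
      "linear_on (lscale L') (lscale L') (lcarrier L') (lbracket L' (snd x))"
      "linear_on (lscale L') (lscale L') (lcarrier L') (\<lambda>y. lbracket L' y (snd x))"
      using assms by (auto intro: lie_superalgebraD)
    then show
      "linear_on (lscale (direct_sum L L')) (lscale (direct_sum L L'))
         (lcarrier L \<times> lcarrier L') (lbracket (direct_sum L L') x)"
      "linear_on (lscale (direct_sum L L')) (lscale (direct_sum L L'))
         (lcarrier L \<times> lcarrier L') (\<lambda>y. lbracket (direct_sum L L') y x)"
      by (auto simp: linear_on_def direct_sum_def)
  next
    fix p q x y
    assume x: "x \<in> lpart (direct_sum L L') p" and y: "y \<in> lpart (direct_sum L L') q"
    have xy: "fst x \<in> lpart L p" "fst y \<in> lpart L q" "snd x \<in> lpart L' p" "snd y \<in> lpart L' q"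
      using x y by (auto simp: direct_sum_def)
    show "lbracket (direct_sum L L') x y \<in> lpart (direct_sum L L') (p + q)"
      using lie_superalgebraD(5)[OF assms(1) xy(1,2)] lie_superalgebraD(5)[OF assms(2) xy(3,4)]
      by (simp add: direct_sum_def)
    have "lbracket L (fst x) (fst y) = lscale L (- koszul_sign p q) (lbracket L (fst y) (fst x))"
      "lbracket L' (snd x) (snd y) = lscale L' (- koszul_sign p q) (lbracket L' (snd y) (snd x))"
      by (rule lie_superalgebraD(6); use assms xy in blast)+
    then show "lbracket (direct_sum L L') x y =
        lscale (direct_sum L L') (- koszul_sign p q) (lbracket (direct_sum L L') y x)"
      by (simp add: direct_sum_def)
    fix r z assume z: "z \<in> lpart (direct_sum L L') r"
    then have z': "fst z \<in> lpart L r" "snd z \<in> lpart L' r"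
      by (auto simp: direct_sum_def)
    have "lbracket L (fst x) (lbracket L (fst y) (fst z)) =
        lbracket L (lbracket L (fst x) (fst y)) (fst z)
          + lscale L (koszul_sign p q) (lbracket L (fst y) (lbracket L (fst x) (fst z)))"
      "lbracket L' (snd x) (lbracket L' (snd y) (snd z)) =
        lbracket L' (lbracket L' (snd x) (snd y)) (snd z)
          + lscale L' (koszul_sign p q) (lbracket L' (snd y) (lbracket L' (snd x) (snd z)))"
      by (rule lie_superalgebraD(7); use assms xy z' in blast)+
    then show "lbracket (direct_sum L L') x (lbracket (direct_sum L L') y z) =
        lbracket (direct_sum L L') (lbracket (direct_sum L L') x y) z
          + lscale (direct_sum L L') (koszul_sign p q)
              (lbracket (direct_sum L L') y (lbracket (direct_sum L L') x z))"
      by (simp add: direct_sum_def)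
  qed
qed

lemma lie_superalgebra_g_alg: "abelian_lie_algebra A \<Longrightarrow> lie_superalgebra (g_alg A)"
  unfolding g_alg_def abelian_lie_algebra_def
  by (blast intro: lie_superalgebra_direct_sum lie_superalgebra_quadratic)

lemma lie_superalgebra_sub:
  assumes L: "lie_superalgebra L"
    and sub: "\<And>p. P p \<subseteq> lpart L p" "\<And>p. module.subspace (lscale L) (P p)"
    and cl: "\<And>p q x y. x \<in> P p \<Longrightarrow> y \<in> P q \<Longrightarrow> lbracket L x y \<in> P (p + q)"
  shows "lie_superalgebra (L\<lparr>lpart := P\<rparr>)"
proof -
  interpret vector_space "lscale L" using L by (rule lie_superalgebraD)
  have car: "lcarrier (L\<lparr>lpart := P\<rparr>) \<subseteq> lcarrier L"
    using sub(1) by (fastforce simp: lcarrier_def)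
  have mono: "linear_on s s' W f" if "linear_on s s' W' f" "W \<subseteq> W'"
    for s :: "complex \<Rightarrow> 'a \<Rightarrow> 'a" and s' :: "complex \<Rightarrow> 'a \<Rightarrow> 'a" and W W' f
    using that unfolding linear_on_def by blast
  have e: "lscale (L\<lparr>lpart := P\<rparr>) = lscale L" "lpart (L\<lparr>lpart := P\<rparr>) = P"
    "lbracket (L\<lparr>lpart := P\<rparr>) = lbracket L" by simp_all
  have c1: "P 0 \<inter> P 1 = {0}"
  proof
    show "P 0 \<inter> P 1 \<subseteq> {0}"
      using lie_superalgebraD(8)[OF L] sub(1)[of 0] sub(1)[of 1] by blast
    show "{0} \<subseteq> P 0 \<inter> P 1" using sub(2) by (simp add: subspace_0)
  qed
  have c2: "\<forall>x\<in>lcarrier (L\<lparr>lpart := P\<rparr>).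
      linear_on (lscale L) (lscale L) (lcarrier (L\<lparr>lpart := P\<rparr>)) (lbracket L x)"
    using lie_superalgebraD(3)[OF L] car mono by (meson subsetD)
  have c3: "\<forall>y\<in>lcarrier (L\<lparr>lpart := P\<rparr>).
      linear_on (lscale L) (lscale L) (lcarrier (L\<lparr>lpart := P\<rparr>)) (\<lambda>x. lbracket L x y)"
    using lie_superalgebraD(4)[OF L] car mono by (meson subsetD)
  have c4: "\<forall>p q. \<forall>x\<in>P p. \<forall>y\<in>P q.
        lbracket L x y = lscale L (- koszul_sign p q) (lbracket L y x)"
    using sub(1) by (intro allI ballI lie_superalgebraD(6)[OF L]) (auto dest: subsetD)
  have c5: "\<forall>p q r. \<forall>x\<in>P p. \<forall>y\<in>P q. \<forall>z\<in>P r.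
        lbracket L x (lbracket L y z) = lbracket L (lbracket L x y) z
            + lscale L (koszul_sign p q) (lbracket L y (lbracket L x z))"
    using sub(1) by (intro allI ballI lie_superalgebraD(7)[OF L]) (auto dest: subsetD)
  show ?thesis
    unfolding lie_superalgebra_def e
    by (intro conjI vector_space_axioms c1 c2 c3 c4 c5) (use sub(2) cl in blast)+
qed

lemma lie_superalgebra_k_alg: "abelian_lie_algebra A \<Longrightarrow> lie_superalgebra (k_alg A)"
proof -
  assume A: "abelian_lie_algebra A"
  have sub: "lpart (k_alg A) p \<subseteq> lpart (g_alg A) p" for p
    by (auto simp: k_alg_def g_alg_def direct_sum_def quadratic_def qspan_def)
  have cl: "qbracket x y \<in> qspan {b. b \<notin> range S2}" for x y
  proof -
    have "x \<in> qspan UNIV" "y \<in> qspan UNIV" by (auto simp: qspan_def)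
    then show ?thesis
    proof (induction x rule: qspan_induct)
      case (base c b)
      show ?case using \<open>y \<in> _\<close>
      proof (induction rule: qspan_induct)
        case (base c' b')
        have "qbracket_basis b b' \<in> qspan {b. b \<notin> range S2}"
          by (cases b; cases b') (auto simp: qspan_def)
        then show ?case
          by (auto simp: qbracket_scale_left qbracket_scale_right
          intro!: quad.subspace_scale subspace_qspan)
       qed (auto simp: qbracket_add_right intro!: quad.subspace_add quad.subspace_0 subspace_qspan)
    qed (auto simp: qbracket_add_left intro!: quad.subspace_add quad.subspace_0 subspace_qspan)
  qed
  have kk: "x \<in> lpart (k_alg A) p \<longleftrightarrow> x \<in> lpart (g_alg A) p \<and> snd x \<in> qspan {b. b \<notin> range S2}" for x p
    by (cases x) (auto simp: k_alg_def g_alg_def direct_sum_def quadratic_def qspan_def)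
  have br: "snd (lbracket (g_alg A) x y) \<in> qspan {b. b \<notin> range S2}" for x y
    using cl by (simp add: g_alg_def direct_sum_def quadratic_def)
  have G: "lie_superalgebra (g_alg A)" by (rule lie_superalgebra_g_alg[OF A])
  interpret c: vector_space "lscale (g_alg A)" using G by (rule lie_superalgebraD)
  have sp: "c.subspace (lpart (k_alg A) p)" for p
  proof -
    have "c.subspace (lpart (g_alg A) p)" using G by (rule lie_superalgebraD)
    then show ?thesis
      using subspace_qspan[of "{b. b \<notin> range S2}"]
      unfolding c.subspace_def quad.subspace_def
      by (auto simp: kk) (simp add: g_alg_def direct_sum_def quadratic_def)
  qed
  have closed: "lbracket (g_alg A) x y \<in> lpart (k_alg A) (p + q)"
    if "x \<in> lpart (k_alg A) p" "y \<in> lpart (k_alg A) q" for p q x y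
    using lie_superalgebraD(5)[OF G] that br unfolding kk by blast
  have "k_alg A = (g_alg A)\<lparr>lpart := lpart (k_alg A)\<rparr>" by (simp add: k_alg_def)
  then show ?thesis
    using lie_superalgebra_sub[OF G sub sp closed] by simp
qed

lemma S_proj_S_space: "z \<in> S_space \<Longrightarrow> S_proj z = z"
  by (cases z, auto simp: S_space_def S_proj_def qspan_def Int_absorb2 intro!: poly_mapping_eqI)
     (auto simp: lookup_sum lookup_single when_def in_keys_iff sum.delta)

lemma S_proj_k_alg: "x \<in> lcarrier (k_alg A) \<Longrightarrow> S_proj x = 0"
proof -
  assume "x \<in> lcarrier (k_alg A)"
  then obtain y z where "x = y + z" "y \<in> lpart (k_alg A) 0" "z \<in> lpart (k_alg A) 1"
    by (auto simp: lcarrier_def)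
  then have "x = y + z" "Poly_Mapping.keys (snd y) \<subseteq> {b. b \<notin> range S2}"
    "Poly_Mapping.keys (snd z) \<subseteq> {b. b \<notin> range S2}"
    by (auto simp: k_alg_def qspan_def)
  then have "Poly_Mapping.keys (snd x) \<subseteq> {b. b \<notin> range S2}"
    using keys_add[of "snd y" "snd z"] by auto
  then have "Poly_Mapping.keys (snd x) \<inter> range S2 = {}" by blast
  then show ?thesis unfolding S_proj_def by (simp add: zero_prod_def)
qed

lemma Omega_act_k:
  fixes V :: "('a::ab_group_add \<times> quad, 'v::ab_group_add) super_module"
  assumes "vector_space (mscale V)" "linear_on s (*) S_space \<rho>"
    "linear_on s (mscale V) S_space (\<lambda>z. \<phi> z v)" "x \<in> lcarrier (k_alg A)"
  shows "mact (Omega \<rho> \<phi> V) x v = mact V x v"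
proof -
  interpret vector_space "mscale V" by fact
  have 0: "(0::'a \<times> quad) \<in> S_space" by (simp add: S_space_def zero_prod_def qspan_def)
  have "\<rho> 0 = 0" "\<phi> 0 v = 0"
    using assms(2,3) 0 unfolding linear_on_def by (metis add_cancel_right_right)+
  then show ?thesis using S_proj_k_alg[OF assms(4)] by (simp add: Omega_def k_proj_def)
qed

lemma Omega_act_S:
  assumes "z \<in> S_space" "mact V 0 v = 0"
  shows "mact (Omega \<rho> \<phi> V) z v = mscale V (\<rho> z) v + \<phi> z v"
  using assms by (simp add: Omega_def k_proj_def S_proj_S_space)

end

theory Submission
  imports Defs "HOL-Library.Function_Algebras"
    "HOL-Computational_Algebra.Fundamental_Theorem_Algebra"
begin

text \<open>
  A finite dimensional simple \<open>\<gg>\<close>-module \<open>M\<close> already is simple over \<open>\<kk>\<close>, and \<open>V\<close> is \<open>M\<close> itself.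

  The even part \<open>\<kk>\<^sub>0\<close> is central in \<open>\<gg>\<close>, so it acts by scalars, which defines \<open>\<lambda>\<close>
  (\<open>schur\<close>, \<open>act_k0\<close>). Therefore \<open>\<gg>\<^sub>1\<close> acts by operators that satisfy the Clifford relation of
  \<open>f\<^sub>\<lambda>\<close>. The radical of \<open>f\<^sub>\<lambda>\<close> acts by anticommuting operators of square zero, and these have a
  nonzero common kernel. For \<open>z \<in> \<S>\<close> the derivation \<open>ad z\<close> is skew for \<open>f\<^sub>\<lambda>\<close> and so preserves the
  radical; hence the common kernel is a graded submodule, and the radical acts by zero
  (\<open>rad_acts_zero\<close>). Orthonormal vectors of \<open>\<gg>\<^sub>1\<close> act by linearly independent operators, so their
  number is bounded, and a maximal orthonormal family spans \<open>\<gg>\<^sub>1\<close> modulo the radical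
  (\<open>complete_orthonormal_exists\<close>). In particular \<open>\<lambda>\<close> is coradical-finite.

  With such a family, \<open>\<phi> z = (1/2) \<Sum> [z,e] e\<close> is the element of the Clifford algebra whose commutator
  with \<open>\<gg>\<^sub>1\<close> is \<open>ad z\<close> (\<open>phi_commutator\<close>). Any operator with this commutation property commutes with
  all \<open>\<phi> z'\<close> (\<open>derivation_commutes_phi\<close>). So \<open>z - \<phi> z\<close> commutes with \<open>\<gg>\<close>, and Schur's lemma makes
  it a scalar \<open>\<rho>(z)\<close> (\<open>act_S\<close>). Thus \<open>\<S>\<close> acts through scalars and products of elements of
  \<open>\<kk>\<^sub>1\<close>: graded \<open>\<kk>\<close>-submodules are \<open>\<gg>\<close>-submodules, and \<open>M\<close> equals
  \<open>\<Omega>\<close> of its own restriction to \<open>\<kk>\<close>, with the identity as isomorphism.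
\<close>

section \<open>Linear algebra of finite dimensional complex spaces\<close>

text \<open>Pointwise scalar multiplication on maps \<open>V \<rightarrow> V\<close>, linear or not, so that operators form a
  vector space in their own right.\<close>

definition op_scale :: "('a \<Rightarrow> 'b \<Rightarrow> 'b) \<Rightarrow> 'a \<Rightarrow> ('b \<Rightarrow> 'b) \<Rightarrow> 'b \<Rightarrow> 'b" where
  "op_scale s c f = (\<lambda>v. s c (f v))"

lemma sum_apply: "(\<Sum>i\<in>I. f i) v = (\<Sum>i\<in>I. f i v)"
  by (induction I rule: infinite_finite_induct) auto

context vector_space
begin

text \<open>More vectors than a spanning set has elements satisfy a linear relation; the family need
  not be injective.\<close>

lemma nontrivial_relation:
  assumes "finite B" "span B = UNIV" "finite I" "card I > card B"
  obtains c where "\<exists>i\<in>I. c i \<noteq> 0" "(\<Sum>i\<in>I. scale (c i) (x i)) = 0"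
proof (cases "inj_on x I")
  case True
  then have "card (x ` I) = card I" by (rule card_image)
  then have "dependent (x ` I)"
    using independent_span_bound[OF assms(1), of "x ` I"] assms(2,4) by auto
  then obtain u where u: "\<exists>v\<in>x ` I. u v \<noteq> 0" "(\<Sum>v\<in>x ` I. scale (u v) v) = 0"
    using dependent_finite[of "x ` I"] assms(3) by auto
  show thesis
  proof (rule that[of "\<lambda>i. u (x i)"])
    show "\<exists>i\<in>I. u (x i) \<noteq> 0" using u(1) by blast
    show "(\<Sum>i\<in>I. scale (u (x i)) (x i)) = 0"
      using u(2) by (simp add: sum.reindex[OF True])
  qed
next
  case False
  then obtain i j where ij: "i \<in> I" "j \<in> I" "i \<noteq> j" "x i = x j"
    by (auto simp: inj_on_def)
  let ?c = "\<lambda>k. if k = i then 1 else if k = j then -1 else 0"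
  have "(\<Sum>k\<in>I. scale (?c k) (x k)) = (\<Sum>k\<in>{i, j}. scale (?c k) (x k))"
    using ij assms(3) by (intro sum.mono_neutral_right) auto
  also have "\<dots> = 0" using ij by simp
  finally show thesis by (intro that[of ?c]) (use ij in auto)
qed

lemma finite_basis_exists:
  assumes "finite B" "span B = UNIV"
  obtains b where "finite b" "independent b" "span b = UNIV"
proof -
  obtain b where b: "independent b" "UNIV \<subseteq> span b" using basis_exists[of UNIV] by metis
  then show thesis
    using that independent_span_bound[of B b] assms by auto
qed

lemma vector_space_op_scale: "vector_space (op_scale scale)"
  by unfold_locales
    (auto simp: op_scale_def fun_eq_iff scale_right_distrib scale_left_distrib)

lemma linear_operators_finite_span:
  assumes "finite B" "span B = UNIV"
  obtains T where "finite T"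
    "\<And>f. Vector_Spaces.linear scale scale f \<Longrightarrow> f \<in> module.span (op_scale scale) T"
proof -
  interpret op: vector_space "op_scale scale" by (rule vector_space_op_scale)
  obtain b where b: "finite b" "independent b" "span b = UNIV"
    using finite_basis_exists[OF assms] .
  \<comment> \<open>the elementary operators, sending \<open>v\<close> to its \<open>i\<close>-th coordinate times \<open>j\<close>\<close>
  define e where "e = (\<lambda>(i, j) v. scale (representation b v i) j)"
  have expand: "(\<Sum>i\<in>b. scale (representation b v i) i) = v" for v
    using sum_representation_eq[of b v b] b by auto
  show thesis
  proof (rule that[of "e ` (b \<times> b)"])
    show "finite (e ` (b \<times> b))" using b by simp
    fix f assume f: "Vector_Spaces.linear scale scale f"
    interpret f: Vector_Spaces.linear scale scale f by fact
    have "f v = (\<Sum>i\<in>b. \<Sum>j\<in>b. op_scale scale (representation b (f i) j) (e (i, j)) v)" for v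
    proof -
      have "f v = (\<Sum>i\<in>b. scale (representation b v i) (f i))"
        by (subst expand[of v, symmetric]) (simp only: f.sum f.scale)
      also have "\<dots> = (\<Sum>i\<in>b. scale (representation b v i) (\<Sum>j\<in>b. scale (representation b (f i) j) j))"
        by (simp only: expand)
      finally show ?thesis
        by (simp add: scale_sum_right e_def op_scale_def mult.commute)
    qed
    then have "f = (\<Sum>i\<in>b. \<Sum>j\<in>b. op_scale scale (representation b (f i) j) (e (i, j)))"
      unfolding fun_eq_iff sum_apply by blast
    also have "\<dots> \<in> op.span (e ` (b \<times> b))"
      by (intro op.span_sum op.span_scale op.span_base) auto
    finally show "f \<in> op.span (e ` (b \<times> b))" .
  qed
qed

end

text \<open>The value \<open>p(T) v\<close> of a polynomial \<open>p\<close> in an operator \<open>T\<close> at a vector \<open>v\<close>.\<close>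

definition poly_apply :: "(complex \<Rightarrow> 'v::ab_group_add \<Rightarrow> 'v) \<Rightarrow> ('v \<Rightarrow> 'v) \<Rightarrow> 'v \<Rightarrow> complex poly \<Rightarrow> 'v"
  where "poly_apply s T v p = (\<Sum>i\<le>degree p. s (coeff p i) ((T ^^ i) v))"

lemma eigenvector_exists:
  fixes s :: "complex \<Rightarrow> 'v::ab_group_add \<Rightarrow> 'v"
  assumes "vector_space s" "finite B" "module.span s B = UNIV"
    and "Vector_Spaces.linear s s T" "(UNIV :: 'v set) \<noteq> {0}"
  obtains c w where "w \<noteq> 0" "T w = s c w"
proof -
  interpret vector_space s by fact
  interpret T: Vector_Spaces.linear s s T by fact
  obtain v :: 'v where v: "v \<noteq> 0" using assms(5) by blast
  have bound: "poly_apply s T v p = (\<Sum>i\<le>n. s (coeff p i) ((T ^^ i) v))"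
    if "degree p \<le> n" for p n
    unfolding poly_apply_def using that
    by (intro sum.mono_neutral_left) (auto simp: coeff_eq_0)
  have factor: "poly_apply s T v ([:-a, 1:] * q) = T (poly_apply s T v q) - s a (poly_apply s T v q)"
    for a q
  proof -
    let ?n = "degree q"
    have "degree ([:-a, 1:] * q) \<le> Suc ?n"
      using degree_mult_le[of "[:-a, 1:]" q] by simp
    then have "poly_apply s T v ([:-a, 1:] * q)
        = (\<Sum>i\<le>Suc ?n. s (coeff (pCons 0 q) i - a * coeff q i) ((T ^^ i) v))"
      by (subst bound) (auto simp: algebra_simps)
    also have "\<dots> = (\<Sum>i\<le>Suc ?n. s (coeff (pCons 0 q) i) ((T ^^ i) v))
        - s a (\<Sum>i\<le>Suc ?n. s (coeff q i) ((T ^^ i) v))"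
      by (simp add: scale_left_diff_distrib sum_subtractf scale_sum_right
          scale_right_distrib algebra_simps)
    also have "(\<Sum>i\<le>Suc ?n. s (coeff (pCons 0 q) i) ((T ^^ i) v)) = T (poly_apply s T v q)"
      by (subst sum.atMost_Suc_shift) (simp add: poly_apply_def T.sum T.scale)
    also have "(\<Sum>i\<le>Suc ?n. s (coeff q i) ((T ^^ i) v)) = poly_apply s T v q"
      by (rule bound[symmetric]) simp
    finally show ?thesis .
  qed
  \<comment> \<open>Split off a root \<open>a\<close> of an annihilating polynomial, \<open>p = (X - a) q\<close>: either \<open>q\<close> annihilates
    \<open>v\<close> as well, or \<open>q(T) v\<close> is an eigenvector.\<close>
  have "\<exists>c w. w \<noteq> 0 \<and> T w = s c w" if "p \<noteq> 0" "poly_apply s T v p = 0" for p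
    using that
  proof (induction "degree p" arbitrary: p rule: less_induct)
    case less
    show ?case
    proof (cases "degree p = 0")
      case True
      then have "coeff p 0 \<noteq> 0" using less.prems(1) by (metis leading_coeff_0_iff)
      then have False using less.prems(2) True v by (simp add: poly_apply_def)
      then show ?thesis ..
    next
      case False
      then have "\<not> constant (poly p)" by (simp add: constant_degree)
      then obtain a where "poly p a = 0" using fundamental_theorem_of_algebra by blast
      then obtain q where q: "p = [:-a, 1:] * q" by (auto simp: poly_eq_0_iff_dvd)
      have "q \<noteq> 0" using q less.prems(1) by auto
      then have "degree q < degree p" unfolding q by (subst degree_mult_eq) auto
      then show ?thesis
        using less.hyps \<open>q \<noteq> 0\<close> less.prems(2) factor[of a q] unfolding q by force
    qed
  qed
  moreover obtain p where "p \<noteq> 0" "poly_apply s T v p = 0"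
  proof -
    let ?n = "card B"
    obtain c where c: "\<exists>i\<in>{..?n}. c i \<noteq> 0" "(\<Sum>i\<le>?n. s (c i) ((T ^^ i) v)) = 0"
      using nontrivial_relation[OF assms(2,3), of "{..?n}" "\<lambda>i. (T ^^ i) v"] by auto
    define p where "p = (\<Sum>i\<le>?n. monom (c i) i)"
    have coeff: "coeff p i = (if i \<le> ?n then c i else 0)" for i
      by (simp add: p_def coeff_sum)
    have "degree p \<le> ?n" by (rule degree_le) (simp add: coeff)
    then have "poly_apply s T v p = 0" using c(2) by (subst bound) (auto simp: coeff)
    moreover have "p \<noteq> 0" using c(1) coeff by (metis atMost_iff coeff_0)
    ultimately show thesis by (rule that[rotated])
  qed
  ultimately show thesis using that by blast
qed

section \<open>Brackets in \<open>\<gg>\<close>\<close>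

text \<open>The superalgebra \<open>\<gg> = A \<oplus> \<Q>\<close> for an abelian Lie algebra \<open>A\<close>. Besides the axioms
  of a Lie superalgebra, three facts about its bracket are used: \<open>\<kk>\<^sub>0\<close> is central, \<open>[\<gg>\<^sub>1, \<gg>\<^sub>1] \<subseteq> \<kk>\<^sub>0\<close>, and \<open>\<S>\<close> is
  commutative.\<close>

locale abelian_summand =
  fixes A :: "'a::ab_group_add lie_super"
  assumes abelian: "abelian_lie_algebra A"
begin

abbreviation g_part :: "bit \<Rightarrow> ('a \<times> quad) set" where "g_part \<equiv> lpart (g_alg A)"
abbreviation k0 :: "('a \<times> quad) set" where "k0 \<equiv> lpart (k_alg A) 0"
abbreviation g_scale :: "complex \<Rightarrow> 'a \<times> quad \<Rightarrow> 'a \<times> quad" where "g_scale \<equiv> lscale (g_alg A)"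
abbreviation br :: "'a \<times> quad \<Rightarrow> 'a \<times> quad \<Rightarrow> 'a \<times> quad" where "br \<equiv> lbracket (g_alg A)"

lemma g: "lie_superalgebra (g_alg A)"
  by (rule lie_superalgebra_g_alg[OF abelian])

lemma k: "lie_superalgebra (k_alg A)"
  by (rule lie_superalgebra_k_alg[OF abelian])

sublocale g: vector_space g_scale
  using g by (rule lie_superalgebraD)

lemma k_alg_simps [simp]: "lscale (k_alg A) = g_scale" "lbracket (k_alg A) = br"
  by (simp_all add: k_alg_def)

lemma A_parts: "lpart A 1 = {0}" "lpart A 0 = lcarrier A"
  using abelian by (auto simp: abelian_lie_algebra_def lcarrier_def)

lemma g_part_eq: "g_part p = lpart A p \<times> qspan {b. qparity b = p}"
  by (simp add: g_alg_def direct_sum_def quadratic_def)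

lemma br_eq: "br x y = (lbracket A (fst x) (fst y), qbracket (snd x) (snd y))"
  by (simp add: g_alg_def direct_sum_def quadratic_def)

lemma k_part_eq: "lpart (k_alg A) p = lpart A p \<times> qspan {b. b \<notin> range S2 \<and> qparity b = p}"
  by (simp add: k_alg_def)

lemma k1_eq [simp]: "lpart (k_alg A) 1 = g_part 1"
  by (auto simp: k_part_eq g_part_eq qspan_def image_def)

lemma k0_subset: "k0 \<subseteq> g_part 0"
  by (auto simp: k_part_eq g_part_eq qspan_def)

lemma subspace_g_part: "g.subspace (g_part p)"
  using g by (rule lie_superalgebraD)

lemma subspace_k0: "g.subspace k0"
  using lie_superalgebraD(2)[OF k, of 0] by simp

lemma A_bracket_zero:
  assumes "a \<in> lpart A p" "b \<in> lpart A q"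
  shows "lbracket A a b = 0"
proof -
  have A: "lie_superalgebra A" using abelian by (simp add: abelian_lie_algebra_def)
  interpret A: vector_space "lscale A" using A by (rule lie_superalgebraD)
  have "0 \<in> lpart A 0" using lie_superalgebraD(2)[OF A] by (rule A.subspace_0)
  then have "lpart A r \<subseteq> lcarrier A" for r
    using A_parts by (cases r) auto
  then show ?thesis using abelian assms unfolding abelian_lie_algebra_def by blast
qed

lemma qbracket_vanishes:
  assumes "x \<in> qspan B" "y \<in> qspan C" "\<And>b c. b \<in> B \<Longrightarrow> c \<in> C \<Longrightarrow> qbracket_basis b c = 0"
  shows "qbracket x y = 0"
  unfolding qbracket_def using assms
  by (intro sum.neutral ballI) (auto simp: qspan_def subset_iff)

lemma g_part_in_carrier: "x \<in> g_part p \<Longrightarrow> x \<in> lcarrier (g_alg A)"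
proof -
  assume x: "x \<in> g_part p"
  have 0: "0 \<in> g_part q" for q using subspace_g_part by (rule g.subspace_0)
  have "x = x + 0" "x = 0 + x" by simp_all
  then show ?thesis using x 0 unfolding lcarrier_def by (cases p) blast+
qed

lemma carrier_decomp:
  assumes "x \<in> lcarrier (g_alg A)"
  obtains y z where "y \<in> g_part 0" "z \<in> g_part 1" "x = y + z"
  using assms by (auto simp: lcarrier_def)

lemma S_subset: "S_space \<subseteq> g_part 0"
proof -
  have "g.subspace (g_part 0)" by (rule subspace_g_part)
  from g.subspace_0[OF this] have "0 \<in> lpart A 0" by (auto simp: g_part_eq zero_prod_def)
  then show ?thesis by (auto simp: S_space_def g_part_eq qspan_def)
qed

lemma subspace_S: "g.subspace S_space"
  unfolding g.subspace_def S_space_def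
proof (intro conjI ballI allI)
  have A: "lie_superalgebra A" using abelian by (simp add: abelian_lie_algebra_def)
  interpret A: vector_space "lscale A" using A by (rule lie_superalgebraD)
  show "0 \<in> {0} \<times> qspan (range S2)"
    using quad.subspace_0[OF subspace_qspan] by (simp add: zero_prod_def)
  fix x y :: "'a \<times> quad" and c
  assume x: "x \<in> {0} \<times> qspan (range S2)"
  show "g_scale c x \<in> {0} \<times> qspan (range S2)"
    using x quad.subspace_scale[OF subspace_qspan]
    by (auto simp: g_alg_def direct_sum_def quadratic_def)
  assume "y \<in> {0} \<times> qspan (range S2)"
  then show "x + y \<in> {0} \<times> qspan (range S2)"
    using x quad.subspace_add[OF subspace_qspan] by auto
qed

lemma k0_keys:
  assumes "x \<in> k0"
  shows "snd x \<in> qspan (range T2)"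
proof -
  have "b \<in> range T2" if "b \<notin> range S2" "qparity b = 0" for b
    using that by (cases b) auto
  then have "{b. b \<notin> range S2 \<and> qparity b = 0} \<subseteq> range T2" by blast
  then show ?thesis using assms by (auto simp: k_part_eq qspan_def)
qed

lemma br_k0:
  assumes "x \<in> k0" "y \<in> g_part p"
  shows "br x y = 0" "br y x = 0"
proof -
  have q: "qbracket (snd x) (snd y) = 0"
  proof (rule qbracket_vanishes)
    show "snd x \<in> qspan (range T2)" "snd y \<in> qspan UNIV"
      using k0_keys[OF assms(1)] by (simp_all add: qspan_def)
  qed auto
  have q': "qbracket (snd y) (snd x) = 0"
  proof (rule qbracket_vanishes)
    show "snd x \<in> qspan (range T2)" "snd y \<in> qspan UNIV"
      using k0_keys[OF assms(1)] by (simp_all add: qspan_def)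
    show "qbracket_basis b c = 0" if "c \<in> range T2" for b c
      using that by (cases b) auto
  qed
  show "br x y = 0" "br y x = 0"
    using assms q q' by (auto simp: br_eq k_part_eq g_part_eq zero_prod_def intro: A_bracket_zero)
qed

lemma br_S_S: "z \<in> S_space \<Longrightarrow> z' \<in> S_space \<Longrightarrow> br z z' = 0"
proof -
  assume z: "z \<in> S_space" "z' \<in> S_space"
  then have "qbracket (snd z) (snd z') = 0"
    by (intro qbracket_vanishes[of _ "range S2" _ "range S2"]) (auto simp: S_space_def)
  moreover have "lbracket A (fst z) (fst z') = 0"
    using z S_subset by (intro A_bracket_zero[of _ 0 _ 0]) (auto simp: g_part_eq)
  ultimately show ?thesis by (simp add: br_eq zero_prod_def)
qed

lemma br_S_odd: "z \<in> S_space \<Longrightarrow> x \<in> g_part 1 \<Longrightarrow> br z x \<in> g_part 1"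
  using lie_superalgebraD(5)[OF g, of z 0 x 1] S_subset by auto

lemma br_odd_odd: "x \<in> g_part 1 \<Longrightarrow> y \<in> g_part 1 \<Longrightarrow> br x y \<in> k0"
  using lie_superalgebraD(5)[OF k, of x 1 y 1] by simp

lemma br_odd_sym: "x \<in> g_part 1 \<Longrightarrow> y \<in> g_part 1 \<Longrightarrow> br x y = br y x"
  using lie_superalgebraD(6)[OF g, of x 1 y 1] by (simp add: koszul_sign_def)

text \<open>Since \<open>\<kk>\<^sub>0\<close> is central, the Jacobi identity says that the derivation \<open>ad z\<close> is skew for the
  symmetric bracket \<open>\<gg>\<^sub>1 \<times> \<gg>\<^sub>1 \<rightarrow> \<kk>\<^sub>0\<close>.\<close>

lemma br_S_skew:
  assumes "z \<in> S_space" "x \<in> g_part 1" "y \<in> g_part 1"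
  shows "br (br z x) y + br x (br z y) = 0"
proof -
  have z: "z \<in> g_part 0" using assms S_subset by blast
  have "br z (br x y) = 0" using br_odd_odd[OF assms(2,3)] z by (rule br_k0)
  then show ?thesis
    using lie_superalgebraD(7)[OF g z assms(2,3)] by (simp add: koszul_sign_def)
qed

lemma br_S_commute:
  assumes "z \<in> S_space" "z' \<in> S_space" "x \<in> g_part 1"
  shows "br z (br z' x) = br z' (br z x)"
proof -
  have z: "z \<in> g_part 0" "z' \<in> g_part 0" using assms S_subset by blast+
  have "br 0 x = 0" using br_k0(1)[OF g.subspace_0[OF subspace_k0] assms(3)] .
  then show ?thesis
    using lie_superalgebraD(7)[OF g z assms(3)] br_S_S[OF assms(1,2)] by (simp add: koszul_sign_def)
qed

lemma br_add_left:
  assumes "x \<in> lcarrier (g_alg A)" "y \<in> lcarrier (g_alg A)" "w \<in> lcarrier (g_alg A)"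
  shows "br (x + y) w = br x w + br y w"
  using lie_superalgebraD(4)[OF g assms(3)] assms by (simp add: linear_on_def)

lemma br_scale_left:
  assumes "x \<in> lcarrier (g_alg A)" "w \<in> lcarrier (g_alg A)"
  shows "br (g_scale c x) w = g_scale c (br x w)"
  using lie_superalgebraD(4)[OF g assms(2)] assms by (simp add: linear_on_def)

lemma lookup_S_proj:
  "Poly_Mapping.lookup (snd (S_proj x)) b = (if b \<in> range S2 then Poly_Mapping.lookup (snd x) b else 0)"
  by (auto simp: S_proj_def lookup_sum lookup_single when_def sum.delta in_keys_iff)

lemma S_proj_in_S: "S_proj x \<in> S_space"
proof -
  have "fst (S_proj x) = 0" by (simp add: S_proj_def)
  moreover have "b \<in> range S2" if "b \<in> Poly_Mapping.keys (snd (S_proj x))" for b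
    using that lookup_S_proj[of x b] by (simp add: in_keys_iff split: if_splits)
  ultimately show ?thesis by (auto simp: S_space_def qspan_def mem_Times_iff)
qed

lemma S_proj_add: "S_proj (x + y) = (S_proj x + S_proj y :: 'a \<times> quad)"
proof (rule prod_eqI)
  show "fst (S_proj (x + y)) = fst (S_proj x + S_proj y :: 'a \<times> quad)"
    by (simp add: S_proj_def)
  show "snd (S_proj (x + y)) = snd (S_proj x + S_proj y :: 'a \<times> quad)"
    by (rule poly_mapping_eqI) (simp add: lookup_S_proj lookup_add)
qed

lemma k_proj_even:
  assumes "x \<in> g_part 0"
  shows "k_proj x \<in> k0"
proof -
  have "fst (k_proj x) = fst x" by (simp add: k_proj_def S_proj_def)
  moreover have "b \<notin> range S2 \<and> qparity b = 0" if "b \<in> Poly_Mapping.keys (snd (k_proj x))" for b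
  proof -
    have b: "Poly_Mapping.lookup (snd (k_proj x)) b \<noteq> 0" using that by (simp add: in_keys_iff)
    then have "b \<notin> range S2" by (auto simp: k_proj_def lookup_minus lookup_S_proj)
    moreover from this b have "b \<in> Poly_Mapping.keys (snd x)"
      by (simp add: k_proj_def lookup_minus lookup_S_proj in_keys_iff)
    ultimately show ?thesis using assms by (auto simp: g_part_eq qspan_def)
  qed
  ultimately show ?thesis
    using assms by (auto simp: k_part_eq g_part_eq mem_Times_iff qspan_def)
qed

lemma k_proj_in_k:
  assumes "x \<in> lcarrier (g_alg A)"
  shows "k_proj x \<in> lcarrier (k_alg A)"
proof -
  obtain y z where yz: "y \<in> g_part 0" "z \<in> g_part 1" "x = y + z"
    using assms by (rule carrier_decomp)
  have "z = 0 + z" by simp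
  then have "z \<in> lcarrier (k_alg A)"
    using yz(2) g.subspace_0[OF subspace_k0] unfolding lcarrier_def k1_eq by blast
  then have "S_proj z = 0" by (rule S_proj_k_alg)
  then have "k_proj x = k_proj y + z"
    using yz(3) by (simp add: k_proj_def S_proj_add)
  then show ?thesis using k_proj_even[OF yz(1)] yz(2) unfolding lcarrier_def k1_eq by blast
qed

lemma k_carrier_subset: "lcarrier (k_alg A) \<subseteq> lcarrier (g_alg A)"
  using k0_subset unfolding lcarrier_def k1_eq by blast

end

section \<open>Schur's lemma and the scalar action of \<open>\<kk>\<^sub>0\<close>\<close>

text \<open>A finite dimensional simple \<open>\<gg>\<close>-module \<open>M\<close>.\<close>

locale fd_simple_module = abelian_summand A
  for A :: "'a::ab_group_add lie_super" +
  fixes M :: "('a \<times> quad, 'm::ab_group_add) super_module"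
  assumes simple: "simple_module (g_alg A) M" and fd: "finite_dimensional M"
begin

abbreviation act :: "'a \<times> quad \<Rightarrow> 'm \<Rightarrow> 'm" where "act \<equiv> mact M"
abbreviation sc :: "complex \<Rightarrow> 'm \<Rightarrow> 'm" where "sc \<equiv> mscale M"

lemma lie_module: "lie_module (g_alg A) M"
  using simple by (simp add: simple_module_def)

sublocale vector_space sc
  using lie_module by (simp add: lie_module_def)

lemma nonzero: "(UNIV :: 'm set) \<noteq> {0}"
  using simple by (simp add: simple_module_def)

lemma subspace_mpart: "subspace (mpart M p)"
  using lie_module by (simp add: lie_module_def)

lemma mpart_decomp: obtains v0 v1 where "v0 \<in> mpart M 0" "v1 \<in> mpart M 1" "v = v0 + v1"
proof -
  have "\<forall>v. \<exists>v0\<in>mpart M 0. \<exists>v1\<in>mpart M 1. v = v0 + v1"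
    using lie_module by (simp add: lie_module_def)
  then show thesis using that by blast
qed

lemma mpart_Int: "v \<in> mpart M 0 \<Longrightarrow> v \<in> mpart M 1 \<Longrightarrow> v = 0"
proof -
  have "mpart M 0 \<inter> mpart M 1 = {0}" using lie_module by (simp add: lie_module_def)
  then show "v \<in> mpart M 0 \<Longrightarrow> v \<in> mpart M 1 \<Longrightarrow> v = 0" by blast
qed

lemma linear_act: "x \<in> lcarrier (g_alg A) \<Longrightarrow> Vector_Spaces.linear sc sc (act x)"
  using lie_module by (simp add: lie_module_def)

lemma act_linear:
  assumes "x \<in> g_part p"
  shows "act x (v + w) = act x v + act x w" "act x (v - w) = act x v - act x w"
    "act x (- v) = - act x v" "act x (sc c v) = sc c (act x v)" "act x 0 = 0"
    "act x (\<Sum>i\<in>I. u i) = (\<Sum>i\<in>I. act x (u i))"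
proof -
  interpret x: Vector_Spaces.linear sc sc "act x"
    by (rule linear_act[OF g_part_in_carrier[OF assms]])
  show "act x (v + w) = act x v + act x w" "act x (v - w) = act x v - act x w"
    "act x (- v) = - act x v" "act x (sc c v) = sc c (act x v)" "act x 0 = 0"
    "act x (\<Sum>i\<in>I. u i) = (\<Sum>i\<in>I. act x (u i))"
    by (rule x.add x.diff x.neg x.scale x.zero x.sum)+
qed

lemma act_add:
  "x \<in> lcarrier (g_alg A) \<Longrightarrow> y \<in> lcarrier (g_alg A) \<Longrightarrow> act (x + y) v = act x v + act y v"
  using lie_module by (simp add: lie_module_def linear_on_def)

lemma act_scale: "x \<in> lcarrier (g_alg A) \<Longrightarrow> act (g_scale c x) v = sc c (act x v)"
  using lie_module by (simp add: lie_module_def linear_on_def)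

lemma act_parity: "x \<in> g_part p \<Longrightarrow> v \<in> mpart M q \<Longrightarrow> act x v \<in> mpart M (p + q)"
  using lie_module by (simp add: lie_module_def)

lemma act_bracket:
  "x \<in> g_part p \<Longrightarrow> y \<in> g_part q \<Longrightarrow>
    act (br x y) v = act x (act y v) - sc (koszul_sign p q) (act y (act x v))"
  using lie_module by (simp add: lie_module_def)

lemma act_bracket_even:
  "x \<in> g_part 0 \<Longrightarrow> y \<in> g_part q \<Longrightarrow> act (br x y) v = act x (act y v) - act y (act x v)"
  using act_bracket[of x 0 y q v] by (simp add: koszul_sign_def)

lemma act_zero: "act 0 v = 0"
proof -
  have "0 \<in> lcarrier (g_alg A)"
    by (rule g_part_in_carrier) (rule g.subspace_0[OF subspace_g_part])
  then show ?thesis using act_scale[of 0 0 v] by simp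
qed

lemma act_sum:
  assumes "\<And>i. i \<in> I \<Longrightarrow> x i \<in> g_part p"
  shows "act (\<Sum>i\<in>I. g_scale (c i) (x i)) v = (\<Sum>i\<in>I. sc (c i) (act (x i) v))"
  using assms
proof (induction I rule: infinite_finite_induct)
  case (insert i I)
  have "x i \<in> g_part p" "g_scale (c i) (x i) \<in> g_part p" "(\<Sum>i\<in>I. g_scale (c i) (x i)) \<in> g_part p"
    using insert.prems
    by (auto intro!: g.subspace_scale g.subspace_sum subspace_g_part)
  moreover have "act (\<Sum>i\<in>I. g_scale (c i) (x i)) v = (\<Sum>i\<in>I. sc (c i) (act (x i) v))"
    using insert by simp
  ultimately show ?case
    using insert.hyps by (simp add: act_add act_scale g_part_in_carrier)
qed (simp_all add: act_zero)

text \<open>For an invariant subspace to be graded it suffices that it contains the even component of each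
  of its elements.\<close>

lemma invariant_subspace:
  assumes "subspace W"
    and homogeneous: "\<And>v0 v1. v0 \<in> mpart M 0 \<Longrightarrow> v1 \<in> mpart M 1 \<Longrightarrow> v0 + v1 \<in> W \<Longrightarrow> v0 \<in> W"
    and invariant: "\<And>p x w. x \<in> g_part p \<Longrightarrow> w \<in> W \<Longrightarrow> act x w \<in> W"
  shows "W = {0} \<or> W = UNIV"
proof -
  have "\<exists>w0\<in>W \<inter> mpart M 0. \<exists>w1\<in>W \<inter> mpart M 1. w = w0 + w1" if w: "w \<in> W" for w
  proof -
    obtain w0 w1 where d: "w0 \<in> mpart M 0" "w1 \<in> mpart M 1" "w = w0 + w1" by (rule mpart_decomp)
    have "w0 \<in> W" using homogeneous d w by blast
    moreover have "w - w0 \<in> W" using assms(1) w calculation by (rule subspace_diff)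
    ultimately show ?thesis using d by auto
  qed
  moreover have "act x w \<in> W" if x: "x \<in> lcarrier (g_alg A)" and w: "w \<in> W" for x w
  proof -
    obtain y z where "y \<in> g_part 0" "z \<in> g_part 1" "x = y + z"
      using x by (rule carrier_decomp)
    then show ?thesis
      using invariant w assms(1) by (simp add: act_add g_part_in_carrier subspace_add)
  qed
  ultimately have "graded_submodule (g_alg A) M W"
    using assms(1) unfolding graded_submodule_def by blast
  then show ?thesis using simple by (simp add: simple_module_def)
qed

lemma schur:
  assumes T: "Vector_Spaces.linear sc sc T"
    and even: "\<And>p v. v \<in> mpart M p \<Longrightarrow> T v \<in> mpart M p"
    and commutes: "\<And>p x v. x \<in> g_part p \<Longrightarrow> T (act x v) = act x (T v)"
  shows "\<exists>c. \<forall>v. T v = sc c v"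
proof -
  interpret T: Vector_Spaces.linear sc sc T by fact
  obtain B where "finite B" "span B = UNIV"
    using fd by (auto simp: finite_dimensional_def)
  then obtain c w where w: "w \<noteq> 0" "T w = sc c w"
    using eigenvector_exists[OF vector_space_axioms _ _ T nonzero] by blast
  let ?W = "{v. T v = sc c v}"
  have "?W = {0} \<or> ?W = UNIV"
  proof (rule invariant_subspace)
    show "subspace ?W"
      by (auto simp: subspace_def T.add T.scale scale_right_distrib mult.commute)
  next
    fix v0 v1 assume v: "v0 \<in> mpart M 0" "v1 \<in> mpart M 1" "v0 + v1 \<in> ?W"
    let ?d = "T v0 - sc c v0"
    have "?d = - (T v1 - sc c v1)"
      using v(3) by (simp add: T.add scale_right_distrib algebra_simps)
    moreover have "?d \<in> mpart M 0" "- (T v1 - sc c v1) \<in> mpart M 1"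
      using v even by (auto intro!: subspace_diff subspace_neg subspace_scale subspace_mpart)
    ultimately have "?d = 0" by (metis mpart_Int)
    then show "v0 \<in> ?W" by simp
  next
    fix p x v assume x: "x \<in> g_part p" and v: "v \<in> ?W"
    show "act x v \<in> ?W" using v commutes[OF x] by (simp add: act_linear[OF x])
  qed
  then show ?thesis using w by blast
qed

lemma scalar_unique:
  assumes "\<And>v. sc c v = sc d v"
  shows "c = d"
proof -
  obtain v :: 'm where "v \<noteq> 0" using nonzero by blast
  then show ?thesis using assms[of v] by simp
qed

text \<open>The functional \<open>\<lambda>\<close>: the scalar by which an element of \<open>\<kk>\<^sub>0\<close> acts, an arbitrary number outside
  \<open>\<kk>\<^sub>0\<close> where no such scalar exists.\<close>

definition lam :: "'a \<times> quad \<Rightarrow> complex" where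
  "lam x = (SOME c. \<forall>v. act x v = sc c v)"

lemma act_k0: "x \<in> k0 \<Longrightarrow> act x v = sc (lam x) v"
proof -
  assume x: "x \<in> k0"
  then have x0: "x \<in> g_part 0" using k0_subset by blast
  have "\<exists>c. \<forall>w. act x w = sc c w"
  proof (rule schur)
    show "Vector_Spaces.linear sc sc (act x)" using x0 by (intro linear_act g_part_in_carrier)
    show "act x v \<in> mpart M p" if "v \<in> mpart M p" for p v
      using act_parity[OF x0 that] unfolding add_0 .
    show "act x (act y v) = act y (act x v)" if y: "y \<in> g_part p" for p y v
    proof -
      have "act x (act y v) - act y (act x v) = act (br x y) v"
        by (rule act_bracket_even[OF x0 y, symmetric])
      also have "\<dots> = 0" unfolding br_k0(1)[OF x y] by (rule act_zero)
      finally show ?thesis by simp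
    qed
  qed
  then have "\<forall>w. act x w = sc (lam x) w" unfolding lam_def by (rule someI_ex)
  then show ?thesis ..
qed

lemma k0_carrier: "x \<in> k0 \<Longrightarrow> x \<in> lcarrier (g_alg A)"
  using k0_subset g_part_in_carrier by blast

lemma lam_add: "x \<in> k0 \<Longrightarrow> y \<in> k0 \<Longrightarrow> lam (x + y) = lam x + lam y"
  by (rule scalar_unique)
    (simp add: act_k0[symmetric] act_add k0_carrier scale_left_distrib g.subspace_add subspace_k0)

lemma lam_scale: "x \<in> k0 \<Longrightarrow> lam (g_scale c x) = c * lam x"
proof (rule scalar_unique)
  fix v assume x: "x \<in> k0"
  have "sc (lam (g_scale c x)) v = act (g_scale c x) v"
    using act_k0 g.subspace_scale[OF subspace_k0 x] by simp
  also have "\<dots> = sc (c * lam x) v" using x by (simp add: act_scale k0_carrier act_k0)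
  finally show "sc (lam (g_scale c x)) v = sc (c * lam x) v" .
qed

lemma k0_functional_lam: "k0_functional A lam"
  by (simp add: k0_functional_def linear_on_def lam_add lam_scale)


section \<open>The form on \<open>\<gg>\<^sub>1\<close> and its radical\<close>

abbreviation form :: "'a \<times> quad \<Rightarrow> 'a \<times> quad \<Rightarrow> complex" where "form \<equiv> f_form A lam"
abbreviation rad :: "('a \<times> quad) set" where "rad \<equiv> f_rad A lam"

lemma form_eq: "form x y = lam (br x y)"
  by (simp add: f_form_def)

lemma rad_iff: "x \<in> rad \<longleftrightarrow> x \<in> g_part 1 \<and> (\<forall>y\<in>g_part 1. form x y = 0)"
  by (simp add: f_rad_def)

lemma clifford_relation:
  "x \<in> g_part 1 \<Longrightarrow> y \<in> g_part 1 \<Longrightarrow> act x (act y v) + act y (act x v) = sc (form x y) v"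
  using act_bracket[of x 1 y 1 v] act_k0[OF br_odd_odd, of x y v]
  by (simp add: koszul_sign_def form_eq)

lemma form_sym: "x \<in> g_part 1 \<Longrightarrow> y \<in> g_part 1 \<Longrightarrow> form x y = form y x"
  by (simp add: form_eq br_odd_sym)

lemma form_add:
  "x \<in> g_part 1 \<Longrightarrow> y \<in> g_part 1 \<Longrightarrow> w \<in> g_part 1 \<Longrightarrow> form (x + y) w = form x w + form y w"
  by (simp add: form_eq br_add_left g_part_in_carrier lam_add br_odd_odd)

lemma form_scale:
  "x \<in> g_part 1 \<Longrightarrow> w \<in> g_part 1 \<Longrightarrow> form (g_scale c x) w = c * form x w"
  by (simp add: form_eq br_scale_left g_part_in_carrier lam_scale br_odd_odd)

lemma form_zero: "w \<in> g_part 1 \<Longrightarrow> form 0 w = 0"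
  using form_scale[of 0 w 0] g.subspace_0[OF subspace_g_part] by simp

lemma form_sum:
  assumes "\<And>i. i \<in> I \<Longrightarrow> x i \<in> g_part 1" "w \<in> g_part 1"
  shows "form (\<Sum>i\<in>I. g_scale (c i) (x i)) w = (\<Sum>i\<in>I. c i * form (x i) w)"
  using assms(1)
proof (induction I rule: infinite_finite_induct)
  case (insert i I)
  have "g_scale (c i) (x i) \<in> g_part 1" "(\<Sum>i\<in>I. g_scale (c i) (x i)) \<in> g_part 1"
    using insert.prems
    by (auto intro!: g.subspace_scale g.subspace_sum subspace_g_part)
  then show ?case
    using insert assms(2) by (simp add: form_add form_scale)
qed (simp_all add: form_zero assms(2))

lemma form_S_skew:
  assumes "z \<in> S_space" "x \<in> g_part 1" "y \<in> g_part 1"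
  shows "form (br z x) y = - form x (br z y)"
proof -
  have "lam (br (br z x) y) + lam (br x (br z y)) = lam 0"
    using br_S_skew[OF assms] assms by (simp flip: lam_add add: br_odd_odd br_S_odd)
  also have "lam 0 = 0"
    using lam_scale[OF g.subspace_0[OF subspace_k0], of 0] by simp
  finally show ?thesis by (simp add: form_eq eq_neg_iff_add_eq_0)
qed

lemma rad_S: "z \<in> S_space \<Longrightarrow> x \<in> rad \<Longrightarrow> br z x \<in> rad"
  by (simp add: rad_iff br_S_odd form_S_skew)

text \<open>A finite family in the radical acts by anticommuting operators of square zero, hence has a
  common kernel.\<close>

lemma finite_rad_kernel:
  assumes "finite F" "F \<subseteq> rad"
  shows "\<exists>v. v \<noteq> 0 \<and> (\<forall>x\<in>F. act x v = 0)"
  using assms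
proof (induction F)
  case empty
  then show ?case using nonzero by auto
next
  case (insert x F)
  then obtain v where v: "v \<noteq> 0" "\<forall>y\<in>F. act y v = 0" by auto
  have odd: "x \<in> g_part 1" "\<And>y. y \<in> F \<Longrightarrow> y \<in> g_part 1"
    using insert.prems by (auto simp: rad_iff)
  have anti: "act x (act y w) + act y (act x w) = 0" if "y \<in> insert x F" for y w
    using clifford_relation[of x y w] insert.prems that odd by (auto simp: rad_iff)
  show ?case
  proof (cases "act x v = 0")
    case True
    then show ?thesis using v by auto
  next
    case False
    have "act x (act x v) = 0"
    proof -
      have "sc 2 (act x (act x v)) = 0"
        using anti[of x v] by (metis insertI1 one_add_one scale_left_distrib scale_one)
      then show ?thesis by simp
    qed
    moreover have "act y (act x v) = 0" if "y \<in> F" for y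
    proof -
      show ?thesis using anti[of y v] v that by (simp add: act_linear[OF odd(1)])
    qed
    ultimately show ?thesis using False by blast
  qed
qed

lemma operators_finite_span:
  obtains T where "finite T" "\<And>x. x \<in> g_part p \<Longrightarrow> act x \<in> module.span (op_scale sc) T"
proof -
  obtain B where "finite B" "span B = UNIV"
    using fd by (auto simp: finite_dimensional_def)
  then obtain T where "finite T"
      "\<And>f. Vector_Spaces.linear sc sc f \<Longrightarrow> f \<in> module.span (op_scale sc) T"
    using linear_operators_finite_span by blast
  then show thesis using that linear_act g_part_in_carrier by metis
qed

text \<open>The operators of the radical, possibly infinitely many, span a finite dimensional space, so a
  finite subfamily has the same common kernel.\<close>

lemma rad_kernel_nonzero: "\<exists>v. v \<noteq> 0 \<and> (\<forall>x\<in>rad. act x v = 0)"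
proof -
  interpret op: vector_space "op_scale sc" by (rule vector_space_op_scale)
  obtain T where T: "finite T" "\<And>x. x \<in> g_part 1 \<Longrightarrow> act x \<in> op.span T"
    by (rule operators_finite_span[of 1]) blast
  obtain B where B: "B \<subseteq> act ` rad" "op.independent B" "act ` rad \<subseteq> op.span B"
    using op.basis_exists by metis
  have "B \<subseteq> op.span T" using B(1) T(2) by (auto simp: rad_iff)
  then have "finite B" using op.independent_span_bound[OF T(1) B(2)] by blast
  then obtain F where F: "F \<subseteq> rad" "finite F" "B = act ` F"
    using B(1) by (meson finite_subset_image)
  then obtain v where v: "v \<noteq> 0" "\<forall>x\<in>F. act x v = 0" using finite_rad_kernel by blast
  have "f v = 0" if "f \<in> op.span B" for f
    using that
  proof (induction rule: op.span_induct_alt)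
    case (step c f h)
    then show ?case using F(3) v(2) by (auto simp: op_scale_def)
  qed simp
  then show ?thesis using v(1) B(3) by auto
qed

text \<open>The common kernel of the radical is a graded \<open>\<gg>\<close>-submodule, because \<open>ad z\<close> preserves the
  radical for \<open>z \<in> \<S>\<close>.\<close>

lemma rad_acts_zero:
  assumes "x \<in> rad"
  shows "act x v = 0"
proof -
  let ?K = "{v. \<forall>x\<in>rad. act x v = 0}"
  have "?K = {0} \<or> ?K = UNIV"
  proof (rule invariant_subspace)
    show "subspace ?K"
      using act_linear[of _ 1] by (simp add: rad_iff subspace_def)
  next
    fix v0 v1 assume v: "v0 \<in> mpart M 0" "v1 \<in> mpart M 1" "v0 + v1 \<in> ?K"
    have "act y v0 = 0" if y: "y \<in> rad" for y
    proof -
      have y1: "y \<in> g_part 1" using y by (simp add: rad_iff)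
      have "act y (v0 + v1) = 0" using v(3) y by simp
      then have "act y v0 = - act y v1"
        by (simp add: act_linear[OF y1] eq_neg_iff_add_eq_0)
      moreover have "act y v0 \<in> mpart M 1" "- act y v1 \<in> mpart M 0"
        using act_parity[OF y1 v(1)] subspace_neg[OF subspace_mpart act_parity[OF y1 v(2)]] by auto
      ultimately show ?thesis by (metis mpart_Int)
    qed
    then show "v0 \<in> ?K" by blast
  next
    fix p y v assume y: "y \<in> g_part p" and v: "v \<in> ?K"
    have "act r (act y v) = 0" if r: "r \<in> rad" for r
    proof (cases "p = 1")
      case True
      have "y \<in> g_part 1" using y True by simp
      then show ?thesis
        using clifford_relation[of r y v] r v act_linear(5)[OF y] by (simp add: rad_iff)
    next
      case False
      have y0: "y \<in> g_part 0" using y False by simp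
      have r1: "r \<in> g_part 1" using r by (simp add: rad_iff)
      have kS: "k_proj y \<in> k0" "S_proj y \<in> S_space" "y = k_proj y + S_proj y"
        using k_proj_even[OF y0] S_proj_in_S[of y] by (simp_all add: k_proj_def)
      have "br y r = br (k_proj y) r + br (S_proj y) r"
        by (subst kS(3), rule br_add_left)
          (use kS(1,2) k0_subset S_subset r1 g_part_in_carrier in blast)+
      then have "br y r \<in> rad"
        using br_k0(1)[OF kS(1) r1] rad_S[OF kS(2) r] by simp
      then have "act y (act r v) - act r (act y v) = 0"
        using v by (simp flip: act_bracket_even[OF y0 r1, of v])
      then show ?thesis using r v act_linear(5)[OF y] by simp
    qed
    then show "act y v \<in> ?K" by blast
  qed
  then show ?thesis using rad_kernel_nonzero assms by blast
qed

section \<open>Orthonormal families in \<open>\<gg>\<^sub>1\<close>\<close>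

text \<open>Finite orthonormal families for the complex bilinear (not Hermitian) form \<open>f\<^sub>\<lambda>\<close>.\<close>

definition orthonormal :: "('a \<times> quad) set \<Rightarrow> bool" where
  "orthonormal E \<longleftrightarrow> finite E \<and> E \<subseteq> g_part 1 \<and>
     (\<forall>e\<in>E. \<forall>e'\<in>E. form e e' = (if e = e' then 1 else 0))"

text \<open>Orthonormal vectors act by linearly independent operators: anticommuting a relation with one
  of them isolates its coefficient. So their number is bounded.\<close>

lemma orthonormal_card_bound: "\<exists>N. \<forall>E. orthonormal E \<longrightarrow> card E \<le> N"
proof -
  interpret op: vector_space "op_scale sc" by (rule vector_space_op_scale)
  obtain T where T: "finite T" "\<And>x. x \<in> g_part 1 \<Longrightarrow> act x \<in> op.span T"
    by (rule operators_finite_span[of 1]) blast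
  have "card E \<le> card T" if E: "orthonormal E" for E
  proof -
    have fin: "finite E" and odd: "\<And>e. e \<in> E \<Longrightarrow> e \<in> g_part 1"
      and on: "\<And>e e'. e \<in> E \<Longrightarrow> e' \<in> E \<Longrightarrow> form e e' = (if e = e' then 1 else 0)"
      using E by (auto simp: orthonormal_def)
    have coefficient: "u d = 0"
      if d: "d \<in> E" and rel: "\<And>v. (\<Sum>e\<in>E. sc (u e) (act e v)) = 0" for u d
    proof -
      have "sc (u d) v = 0" for v
      proof -
        have "0 = (\<Sum>e\<in>E. sc (u e) (act e (act d v))) + act d (\<Sum>e\<in>E. sc (u e) (act e v))"
          by (simp add: rel act_linear[OF odd[OF d]])
        also have "\<dots> = (\<Sum>e\<in>E. sc (u e) (act e (act d v) + act d (act e v)))"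
          by (simp add: act_linear[OF odd[OF d]] sum.distrib scale_right_distrib)
        also have "\<dots> = (\<Sum>e\<in>E. if e = d then sc (u e) v else 0)"
          using d by (intro sum.cong) (auto simp: clifford_relation odd on)
        also have "\<dots> = sc (u d) v" using d fin by simp
        finally show ?thesis by simp
      qed
      then show ?thesis using scalar_unique[of "u d" 0] by simp
    qed
    have inj: "inj_on act E"
    proof (rule inj_onI, rule ccontr)
      fix d d' assume dd: "d \<in> E" "d' \<in> E" "act d = act d'" "d \<noteq> d'"
      let ?u = "\<lambda>e. if e = d then 1 else if e = d' then -1 else 0"
      have "(\<Sum>e\<in>E. sc (?u e) (act e v)) = (\<Sum>e\<in>{d, d'}. sc (?u e) (act e v))" for v
        using dd fin by (intro sum.mono_neutral_right) auto
      then have "(\<Sum>e\<in>E. sc (?u e) (act e v)) = 0" for v using dd by simp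
      from coefficient[OF dd(1) this] show False by simp
    qed
    have "op.independent (act ` E)"
    proof
      assume "op.dependent (act ` E)"
      then obtain u where u: "\<exists>f\<in>act ` E. u f \<noteq> 0" "(\<Sum>f\<in>act ` E. op_scale sc (u f) f) = 0"
        using op.dependent_finite[of "act ` E"] fin by auto
      have "(\<Sum>e\<in>E. op_scale sc (u (act e)) (act e)) = 0"
        using u(2) by (simp add: sum.reindex[OF inj])
      then have "(\<Sum>e\<in>E. op_scale sc (u (act e)) (act e)) v = 0" for v by simp
      then have "(\<Sum>e\<in>E. sc (u (act e)) (act e v)) = 0" for v
        by (simp add: sum_apply op_scale_def)
      then have "u (act e) = 0" if "e \<in> E" for e by (rule coefficient[OF that])
      then show False using u(1) by blast
    qed
    then have "card (act ` E) \<le> card T"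
      using op.independent_span_bound[OF T(1)] T(2) odd by blast
    then show ?thesis using inj by (simp add: card_image)
  qed
  then show ?thesis by blast
qed

text \<open>The orthogonal projection of \<open>x\<close> to the span of an orthonormal family.\<close>

definition component :: "('a \<times> quad) set \<Rightarrow> 'a \<times> quad \<Rightarrow> 'a \<times> quad" where
  "component E x = (\<Sum>e\<in>E. g_scale (form x e) e)"

lemma component_odd: "orthonormal E \<Longrightarrow> component E x \<in> g_part 1"
  unfolding component_def orthonormal_def
  by (intro g.subspace_sum g.subspace_scale subspace_g_part) blast

text \<open>An orthonormal family of maximal cardinality spans \<open>\<gg>\<^sub>1\<close> modulo the radical. A vector
  \<open>y\<close> orthogonal to it with \<open>f\<^sub>\<lambda>(y,y) \<noteq> 0\<close> could be normalised by a complex square root and added to the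
  family; so \<open>f\<^sub>\<lambda>\<close> vanishes on the orthogonal complement, by polarisation.\<close>

lemma complete_orthonormal_exists:
  obtains E where "orthonormal E" "\<And>x. x \<in> g_part 1 \<Longrightarrow> x - component E x \<in> rad"
proof -
  have "orthonormal {}" by (simp add: orthonormal_def)
  moreover obtain N where "\<forall>E. orthonormal E \<longrightarrow> card E \<le> N" using orthonormal_card_bound by blast
  ultimately obtain E where E: "orthonormal E" "\<And>E'. orthonormal E' \<Longrightarrow> card E' \<le> card E"
    using ex_has_greatest_nat[of orthonormal "{}" card "Suc N"] by (auto simp: less_Suc_eq_le)
  have fin: "finite E" and odd: "\<And>e. e \<in> E \<Longrightarrow> e \<in> g_part 1"
    and on: "\<And>e e'. e \<in> E \<Longrightarrow> e' \<in> E \<Longrightarrow> form e e' = (if e = e' then 1 else 0)"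
    using E by (auto simp: orthonormal_def)
  define perp where "perp = {x \<in> g_part 1. \<forall>e\<in>E. form x e = 0}"
  have perp_odd: "x \<in> g_part 1" if "x \<in> perp" for x using that by (simp add: perp_def)
  have isotropic: "form y y = 0" if y: "y \<in> perp" for y
  proof (rule ccontr)
    assume ne: "form y y \<noteq> 0"
    define c where "c = 1 / csqrt (form y y)"
    have c: "c * (c * form y y) = 1"
      using ne power2_csqrt[of "form y y"] by (simp add: c_def power2_eq_square field_simps)
    let ?d = "g_scale c y"
    have d: "?d \<in> g_part 1" using perp_odd[OF y] by (intro g.subspace_scale subspace_g_part)
    have dd: "form ?d ?d = 1"
      using c perp_odd[OF y] d by (simp add: form_scale form_sym[of y ?d])
    have de: "form ?d e = 0" "form e ?d = 0" if "e \<in> E" for e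
      using that y odd[OF that] d perp_odd[OF y]
      by (simp_all add: form_sym[of e ?d] form_scale perp_def)
    have "?d \<notin> E" using dd de(1)[of ?d] by auto
    moreover have "orthonormal (insert ?d E)"
      using fin d odd on dd de \<open>?d \<notin> E\<close> unfolding orthonormal_def by auto
    ultimately show False using E(2)[of "insert ?d E"] fin by simp
  qed
  have perp_form: "form x y = 0" if xy: "x \<in> perp" "y \<in> perp" for x y
  proof -
    have o: "x \<in> g_part 1" "y \<in> g_part 1" "x + y \<in> g_part 1"
      using xy[THEN perp_odd] g.subspace_add[OF subspace_g_part] by blast+
    then have "x + y \<in> perp" using xy odd by (simp add: perp_def form_add)
    from isotropic[OF this] have "form x (x + y) + form y (x + y) = 0"
      using o by (simp add: form_add)
    moreover have "form x (x + y) = form x y" "form y (x + y) = form x y"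
      using o isotropic xy
      by (simp_all add: form_sym[of _ "x + y"] form_add form_sym[of y x])
    ultimately show ?thesis by simp
  qed
  have remainder: "x - component E x \<in> perp" if x: "x \<in> g_part 1" for x
  proof -
    have r: "x - component E x \<in> g_part 1"
      using x component_odd[OF E(1)] by (intro g.subspace_diff subspace_g_part)
    have "form (x - component E x) e = 0" if e: "e \<in> E" for e
    proof -
      have "form (component E x) e = (\<Sum>d\<in>E. form x d * form d e)"
        unfolding component_def using odd e by (intro form_sum) auto
      also have "\<dots> = (\<Sum>d\<in>E. if d = e then form x d else 0)"
        using e by (intro sum.cong) (auto simp: on)
      also have "\<dots> = form x e" using e fin by simp
      finally have "form (component E x) e = form x e" .
      moreover have "form ((x - component E x) + component E x) e
          = form (x - component E x) e + form (component E x) e"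
        using r component_odd[OF E(1)] odd[OF e] by (rule form_add)
      ultimately show ?thesis by simp
    qed
    then show ?thesis using r by (simp add: perp_def)
  qed
  have "x - component E x \<in> rad" if x: "x \<in> g_part 1" for x
    unfolding rad_iff
  proof (intro conjI ballI)
    let ?r = "x - component E x"
    show r: "?r \<in> g_part 1" using remainder[OF x] by (rule perp_odd)
    fix y assume y: "y \<in> g_part 1"
    let ?s = "y - component E y"
    have s: "?s \<in> g_part 1" using remainder[OF y] by (rule perp_odd)
    have "form (component E y) ?r = (\<Sum>d\<in>E. form y d * form d ?r)"
      unfolding component_def[of E y] using odd r by (intro form_sum) auto
    also have "\<dots> = 0"
      using remainder[OF x] odd r
      by (intro sum.neutral) (auto simp: perp_def form_sym[of _ ?r])
    finally have "form (component E y) ?r = 0" .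
    moreover have "form ?s ?r = 0" using remainder[OF x] remainder[OF y] perp_form by blast
    moreover have "form (?s + component E y) ?r = form ?s ?r + form (component E y) ?r"
      using s component_odd[OF E(1)] r by (rule form_add)
    ultimately show "form ?r y = 0" using form_sym[OF r y] by simp
  qed
  then show thesis using that E(1) by blast
qed


section \<open>The Clifford realisation of \<open>\<S>\<close>\<close>

text \<open>A chosen finite orthonormal family that represents a basis of \<open>\<gg>\<^sub>1\<close> modulo the radical.\<close>

definition frame :: "('a \<times> quad) set" where
  "frame = (SOME E. orthonormal E \<and> (\<forall>x\<in>g_part 1. x - component E x \<in> rad))"

lemma frame: "orthonormal frame" "x \<in> g_part 1 \<Longrightarrow> x - component frame x \<in> rad"
proof -
  have "\<exists>E. orthonormal E \<and> (\<forall>x\<in>g_part 1. x - component E x \<in> rad)"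
    using complete_orthonormal_exists by metis
  then have "orthonormal frame \<and> (\<forall>x\<in>g_part 1. x - component frame x \<in> rad)"
    unfolding frame_def by (rule someI_ex)
  then show "orthonormal frame" "x \<in> g_part 1 \<Longrightarrow> x - component frame x \<in> rad" by blast+
qed

lemma frame_odd: "e \<in> frame \<Longrightarrow> e \<in> g_part 1"
  using frame(1) by (auto simp: orthonormal_def)

lemma coradical_finite_lam: "coradical_finite A lam"
  unfolding coradical_finite_def finite_dim_quotient_def
proof (intro exI conjI ballI)
  show "finite frame" "frame \<subseteq> lpart (k_alg A) 1"
    using frame(1) by (auto simp: orthonormal_def)
  fix x assume x: "x \<in> lpart (k_alg A) 1"
  have "component frame x \<in> g.span frame"
    unfolding component_def by (intro g.span_sum g.span_scale g.span_base)
  then show "\<exists>b\<in>module.span (lscale (k_alg A)) frame. x - b \<in> rad"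
    using frame(2)[of x] x by auto
qed

lemma frame_expansion:
  assumes "x \<in> g_part 1"
  shows "(\<Sum>e\<in>frame. sc (form x e) (act e v)) = act x v"
proof -
  have "act x v = act ((x - component frame x) + component frame x) v" by simp
  also have "\<dots> = act (x - component frame x) v + act (component frame x) v"
    using frame(2)[OF assms] component_odd[OF frame(1)]
    by (intro act_add g_part_in_carrier[of _ 1]) (auto simp: rad_iff)
  also have "act (component frame x) v = (\<Sum>e\<in>frame. sc (form x e) (act e v))"
    unfolding component_def by (intro act_sum[where p = 1] frame_odd)
  finally show ?thesis using rad_acts_zero[OF frame(2)[OF assms]] by simp
qed

text \<open>The image under \<open>ad z\<close> of the expansion of \<open>x\<close> in the frame; applying \<open>ad z\<close> as a commutator
  of operators takes care of the error in the radical.\<close>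

lemma frame_expansion_S:
  assumes z: "z \<in> S_space" and x: "x \<in> g_part 1"
  shows "(\<Sum>e\<in>frame. sc (form e x) (act (br z e) v)) = act (br z x) v"
proof -
  have zc: "z \<in> g_part 0" using z S_subset by blast
  have act_br: "act (br z y) w = act z (act y w) - act y (act z w)" if "y \<in> g_part 1" for y w
    using act_bracket_even[OF zc that] .
  have "(\<Sum>e\<in>frame. sc (form e x) (act (br z e) v))
      = (\<Sum>e\<in>frame. act z (sc (form x e) (act e v)) - sc (form x e) (act e (act z v)))"
    by (intro sum.cong refl)
      (simp add: act_br frame_odd form_sym[OF x] scale_right_diff_distrib act_linear(4)[OF zc])
  also have "\<dots> = act (br z x) v"
    by (simp only: sum_subtractf flip: act_linear(6)[OF zc]) (simp only: frame_expansion[OF x] act_br[OF x])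
  finally show ?thesis .
qed

text \<open>The derivation \<open>ad z\<close> of \<open>\<gg>\<^sub>1\<close> is skew for \<open>f\<^sub>\<lambda>\<close>, so it is the commutator with an element of
  degree two of the Clifford algebra, namely \<open>(1/2) \<Sum> [z,e] e\<close> over the frame. The operator
  \<open>\<phi> z\<close> is the action of this element.\<close>

definition phi :: "'a \<times> quad \<Rightarrow> 'm \<Rightarrow> 'm" where
  "phi z v = sc (1/2) (\<Sum>e\<in>frame. act (br z e) (act e v))"

lemma linear_phi:
  assumes z: "z \<in> S_space"
  shows "Vector_Spaces.linear sc sc (phi z)"
  by (simp add: Vector_Spaces.linear_iff vector_space_axioms phi_def br_S_odd[OF z] frame_odd
      act_linear[of _ 1] sum.distrib scale_right_distrib scale_sum_right mult.commute)

lemma phi_even: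
  assumes z: "z \<in> S_space" and v: "v \<in> mpart M p"
  shows "phi z v \<in> mpart M p"
proof -
  have "act (br z e) (act e v) \<in> mpart M p" if e: "e \<in> frame" for e
  proof -
    have "act (br z e) (act e v) \<in> mpart M (1 + (1 + p))"
      by (intro act_parity br_S_odd z frame_odd e v)
    moreover have "1 + (1 + p) = p" by (cases p) auto
    ultimately show ?thesis by metis
  qed
  then show ?thesis
    unfolding phi_def by (intro subspace_scale subspace_sum subspace_mpart)
qed

lemma phi_linear_in_S:
  assumes "z \<in> S_space" "z' \<in> S_space"
  shows "phi (z + z') v = phi z v + phi z' v" "phi (g_scale c z) v = sc c (phi z v)"
proof -
  have c: "z \<in> lcarrier (g_alg A)" "z' \<in> lcarrier (g_alg A)"
    using assms S_subset g_part_in_carrier by blast+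
  have e: "e \<in> lcarrier (g_alg A)" "br z e \<in> lcarrier (g_alg A)" "br z' e \<in> lcarrier (g_alg A)"
    if "e \<in> frame" for e
    using frame_odd[OF that] br_S_odd assms g_part_in_carrier by blast+
  show "phi (z + z') v = phi z v + phi z' v"
    by (simp add: phi_def br_add_left c e act_add sum.distrib scale_right_distrib)
  show "phi (g_scale c z) v = sc c (phi z v)"
    by (simp add: phi_def br_scale_left c e act_scale scale_sum_right mult.commute)
qed

lemma phi_commutator:
  assumes z: "z \<in> S_space" and x: "x \<in> g_part 1"
  shows "phi z (act x v) = act x (phi z v) + act (br z x) v"
proof -
  have summand: "act (br z e) (act e (act x v))
      = act x (act (br z e) (act e v))
        + (sc (form e x) (act (br z e) v) + sc (form (br z x) e) (act e v))" if e: "e \<in> frame" for e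
  proof -
    have o: "e \<in> g_part 1" "br z e \<in> g_part 1" using e z by (auto intro: frame_odd br_S_odd)
    have 1: "act e (act x v) = sc (form e x) v - act x (act e v)"
      using clifford_relation[OF o(1) x, of v] by (simp add: eq_diff_eq)
    have 2: "act (br z e) (act x (act e v))
        = sc (form (br z e) x) (act e v) - act x (act (br z e) (act e v))"
      using clifford_relation[OF o(2) x, of "act e v"] by (simp add: eq_diff_eq)
    have 3: "form (br z e) x = - form (br z x) e"
      using form_S_skew[OF z o(1) x] form_sym[OF o(1) br_S_odd[OF z x]] by simp
    show ?thesis
      by (simp add: 1 2 3 act_linear[OF o(2)])
  qed
  have "phi z (act x v) = sc (1/2) (\<Sum>e\<in>frame. act x (act (br z e) (act e v))
        + (sc (form e x) (act (br z e) v) + sc (form (br z x) e) (act e v)))"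
    unfolding phi_def by (simp add: summand)
  also have "\<dots> = act x (phi z v) + sc (1/2) (act (br z x) v + act (br z x) v)"
    by (simp add: sum.distrib frame_expansion_S[OF z x] frame_expansion[OF br_S_odd[OF z x]]
        phi_def act_linear[OF x] scale_right_distrib)
  also have "sc (1/2) (act (br z x) v + act (br z x) v) = sc (1/2 + 1/2) (act (br z x) v)"
    by (simp only: scale_right_distrib scale_left_distrib)
  also have "\<dots> = act (br z x) v" by simp
  finally show ?thesis .
qed

text \<open>Let \<open>F\<close> be an operator whose commutator with \<open>\<gg>\<^sub>1\<close> is \<open>ad z\<close>; both \<open>\<phi> z\<close> and the action of \<open>z\<close> are
  of this kind. Modulo the radical, \<open>ad z\<close> commutes with \<open>ad z'\<close> and leaves the tensor
  \<open>\<Sum> e \<otimes> e\<close> invariant, so that the two terms that arise when \<open>F\<close> is moved past the summands of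
  \<open>\<phi> z'\<close> cancel in the sum.\<close>

lemma derivation_commutes_phi:
  assumes z: "z \<in> S_space" and z': "z' \<in> S_space"
    and F: "Vector_Spaces.linear sc sc F"
    and derivation: "\<And>x v. x \<in> g_part 1 \<Longrightarrow> F (act x v) = act x (F v) + act (br z x) v"
  shows "F (phi z' v) = phi z' (F v)"
proof -
  interpret F: Vector_Spaces.linear sc sc F by fact
  have "(\<Sum>e\<in>frame. act (br z' e) (act (br z e) v))
      = (\<Sum>e\<in>frame. \<Sum>d\<in>frame. sc (form (br z e) d) (act (br z' e) (act d v)))"
    by (intro sum.cong refl)
      (simp add: act_linear[OF br_S_odd[OF z' frame_odd]] flip: frame_expansion[OF br_S_odd[OF z frame_odd]])
  also have "\<dots> = (\<Sum>d\<in>frame. \<Sum>e\<in>frame. sc (form (br z e) d) (act (br z' e) (act d v)))"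
    by (rule sum.swap)
  also have "\<dots> = (\<Sum>d\<in>frame. - (\<Sum>e\<in>frame. sc (form e (br z d)) (act (br z' e) (act d v))))"
    by (intro sum.cong refl) (simp add: form_S_skew[OF z] frame_odd sum_negf)
  also have "\<dots> = - (\<Sum>d\<in>frame. act (br z' (br z d)) (act d v))"
    by (simp add: frame_expansion_S[OF z' br_S_odd[OF z frame_odd]] sum_negf)
  finally have cancel: "(\<Sum>e\<in>frame. act (br z' e) (act (br z e) v))
      + (\<Sum>e\<in>frame. act (br z (br z' e)) (act e v)) = 0"
    by (simp add: br_S_commute[OF z' z frame_odd])
  have "F (phi z' v) = sc (1/2) (\<Sum>e\<in>frame. act (br z' e) (act e (F v))
      + (act (br z' e) (act (br z e) v) + act (br z (br z' e)) (act e v)))"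
    unfolding phi_def F.scale F.sum
    by (intro arg_cong[where f = "sc (1/2)"] sum.cong refl)
      (simp add: derivation frame_odd br_S_odd[OF z'] act_linear[OF br_S_odd[OF z' frame_odd]])
  also have "\<dots> = phi z' (F v)"
    by (simp add: sum.distrib cancel phi_def)
  finally show ?thesis .
qed

lemma phi_commute:
  assumes "z \<in> S_space" "z' \<in> S_space"
  shows "phi z (phi z' v) = phi z' (phi z v)"
  by (rule derivation_commutes_phi[OF assms linear_phi[OF assms(1)] phi_commutator[OF assms(1)]])

lemma act_S_derivation:
  assumes "z \<in> S_space" "x \<in> g_part p"
  shows "act z (act x v) = act x (act z v) + act (br z x) v"
proof -
  have "z \<in> g_part 0" using assms S_subset by blast
  from act_bracket_even[OF this assms(2)] show ?thesis by simp
qed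

lemma act_phi_commute:
  assumes "z \<in> S_space" "z' \<in> S_space"
  shows "act z (phi z' v) = phi z' (act z v)"
proof -
  have "z \<in> g_part 0" using assms S_subset by blast
  then have "Vector_Spaces.linear sc sc (act z)" by (intro linear_act g_part_in_carrier)
  from derivation_commutes_phi[OF assms this act_S_derivation[OF assms(1)]] show ?thesis .
qed

text \<open>The functional \<open>\<rho>\<close>: for \<open>z \<in> \<S>\<close> the operator \<open>z - \<phi> z\<close> commutes with \<open>\<gg>\<close>, hence is a
  scalar.\<close>

definition rho :: "'a \<times> quad \<Rightarrow> complex" where
  "rho z = (SOME c. \<forall>v. act z v - phi z v = sc c v)"

lemma act_S:
  assumes z: "z \<in> S_space"
  shows "act z v = sc (rho z) v + phi z v"
proof -
  have zc: "z \<in> g_part 0" using z S_subset by blast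
  interpret phi: Vector_Spaces.linear sc sc "phi z" by (rule linear_phi[OF z])
  have "\<exists>c. \<forall>v. act z v - phi z v = sc c v"
  proof (rule schur)
    show "Vector_Spaces.linear sc sc (\<lambda>v. act z v - phi z v)"
      by (simp add: Vector_Spaces.linear_iff vector_space_axioms act_linear[OF zc] phi.add phi.scale
          scale_right_diff_distrib)
    show "act z v - phi z v \<in> mpart M p" if "v \<in> mpart M p" for p v
    proof (rule subspace_diff[OF subspace_mpart])
      show "act z v \<in> mpart M p" using act_parity[OF zc that] unfolding add_0 .
      show "phi z v \<in> mpart M p" by (rule phi_even[OF z that])
    qed
    fix p x v assume x: "x \<in> g_part p"
    show "act z (act x v) - phi z (act x v) = act x (act z v - phi z v)"
    proof (cases "p = 1")
      case True
      then have "x \<in> g_part 1" using x by simp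
      then show ?thesis
        by (simp add: act_S_derivation[OF z] phi_commutator[OF z] act_linear)
    next
      case False
      then have "x \<in> g_part 0" using x by simp
      then have kS: "k_proj x \<in> k0" "S_proj x \<in> S_space" "x = k_proj x + S_proj x"
        using k_proj_even[of x] S_proj_in_S[of x] by (simp_all add: k_proj_def)
      have S: "S_proj x \<in> g_part 0" using kS S_subset by blast
      have act_x: "act x w = sc (lam (k_proj x)) w + act (S_proj x) w" for w
        using kS(1) S by (subst kS(3), subst act_add) (simp_all add: k0_carrier g_part_in_carrier act_k0)
      have "act z (act (S_proj x) v) = act (S_proj x) (act z v)"
        using act_S_derivation[OF z S] br_S_S[OF z kS(2)] act_zero by simp
      moreover have "phi z (act (S_proj x) v) = act (S_proj x) (phi z v)"
        using act_phi_commute[OF kS(2) z] by simp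
      ultimately show ?thesis
        by (simp add: act_x act_linear[OF zc] act_linear[OF S] phi.add phi.scale
            scale_right_diff_distrib)
    qed
  qed
  then have "\<forall>v. act z v - phi z v = sc (rho z) v" unfolding rho_def by (rule someI_ex)
  then show ?thesis by (simp add: diff_eq_eq)
qed

lemma linear_rho: "linear_on g_scale (*) S_space rho"
  unfolding linear_on_def
proof (intro conjI ballI allI)
  fix z z' :: "'a \<times> quad" and c
  assume z: "z \<in> S_space"
  have carrier: "u \<in> lcarrier (g_alg A)" if "u \<in> S_space" for u :: "'a \<times> quad"
    using that S_subset g_part_in_carrier by blast
  have rho_eq: "sc (rho u) v = act u v - phi u v" if "u \<in> S_space" for u v
    using act_S[OF that, of v] by simp
  show "rho (g_scale c z) = c * rho z"
  proof (rule scalar_unique)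
    fix v
    have "sc (rho (g_scale c z)) v = sc c (sc (rho z) v)"
      using z g.subspace_scale[OF subspace_S z]
      by (simp only: rho_eq act_scale[OF carrier] phi_linear_in_S(2)[OF z z] scale_right_diff_distrib)
    then show "sc (rho (g_scale c z)) v = sc (c * rho z) v" by simp
  qed
  assume z': "z' \<in> S_space"
  show "rho (z + z') = rho z + rho z'"
    using z z' g.subspace_add[OF subspace_S z z']
    by (intro scalar_unique)
      (simp add: rho_eq act_add carrier phi_linear_in_S(1) scale_left_distrib)
qed


section \<open>Restriction to \<open>\<kk>\<close>\<close>

lemma act_decomposition:
  assumes "x \<in> lcarrier (g_alg A)"
  shows "act x v = act (k_proj x) v + (sc (rho (S_proj x)) v + phi (S_proj x) v)"
proof -
  have "S_proj x \<in> lcarrier (g_alg A)"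
    using S_proj_in_S S_subset g_part_in_carrier by blast
  moreover have "k_proj x \<in> lcarrier (g_alg A)"
    using k_proj_in_k[OF assms] k_carrier_subset by blast
  moreover have "x = k_proj x + S_proj x" by (simp add: k_proj_def)
  ultimately have "act x v = act (k_proj x) v + act (S_proj x) v"
    using act_add by metis
  then show ?thesis by (simp add: act_S[OF S_proj_in_S])
qed

lemma k_part_subset: "lpart (k_alg A) p \<subseteq> g_part p"
  using k0_subset by (cases p) auto

lemma lie_module_k: "lie_module (k_alg A) M"
proof -
  have "linear_on g_scale sc (lcarrier (k_alg A)) (\<lambda>x. act x v)" for v
    using k_carrier_subset act_add act_scale unfolding linear_on_def by blast
  moreover have "Vector_Spaces.linear sc sc (act x)" if "x \<in> lcarrier (k_alg A)" for x
    using that k_carrier_subset linear_act by blast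
  moreover have "\<forall>v. \<exists>v0\<in>mpart M 0. \<exists>v1\<in>mpart M 1. v = v0 + v1"
    using mpart_decomp by metis
  moreover have "mpart M 0 \<inter> mpart M 1 = {0}"
    using lie_module by (simp add: lie_module_def)
  moreover have "act x v \<in> mpart M (p + q)"
    if "x \<in> lpart (k_alg A) p" "v \<in> mpart M q" for p q x v
    using act_parity[of x p v q] that k_part_subset by blast
  moreover have "act (br x y) v = act x (act y v) - sc (koszul_sign p q) (act y (act x v))"
    if "x \<in> lpart (k_alg A) p" "y \<in> lpart (k_alg A) q" for p q x y v
    using act_bracket[of x p y q v] that k_part_subset by blast
  ultimately show ?thesis
    unfolding lie_module_def k_alg_simps
    by (intro conjI allI ballI vector_space_axioms subspace_mpart) simp_all
qed

text \<open>Since \<open>\<S>\<close> acts through scalars and products of elements of \<open>\<gg>\<^sub>1 = \<kk>\<^sub>1\<close>, every graded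
  \<open>\<kk>\<close>-submodule is a \<open>\<gg>\<close>-submodule.\<close>

lemma is_V_c_M: "is_V_c A lam M"
proof -
  have "W = {0} \<or> W = UNIV" if W: "graded_submodule (k_alg A) M W" for W
  proof -
    have sub: "subspace W" and k: "\<And>x w. x \<in> lcarrier (k_alg A) \<Longrightarrow> w \<in> W \<Longrightarrow> act x w \<in> W"
      using W by (auto simp: graded_submodule_def)
    have odd: "act x w \<in> W" if x: "x \<in> g_part 1" and "w \<in> W" for x w
    proof -
      have "x = 0 + x" by simp
      then have "x \<in> lcarrier (k_alg A)"
        using x g.subspace_0[OF subspace_k0] unfolding lcarrier_def k1_eq by blast
      then show ?thesis using k that(2) by blast
    qed
    have "phi z w \<in> W" if "z \<in> S_space" "w \<in> W" for z w
      unfolding phi_def using that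
      by (intro subspace_scale subspace_sum sub odd br_S_odd frame_odd)
    then have "act x w \<in> W" if x: "x \<in> lcarrier (g_alg A)" and w: "w \<in> W" for x w
      unfolding act_decomposition[OF x]
      using w S_proj_in_S k k_proj_in_k[OF x]
      by (intro subspace_add subspace_scale sub) blast+
    then have "graded_submodule (g_alg A) M W"
      using W by (simp add: graded_submodule_def)
    then show ?thesis using simple by (simp add: simple_module_def)
  qed
  then show ?thesis
    using lie_module_k nonzero fd act_k0 by (simp add: is_V_c_def simple_module_def)
qed

lemma even_linear_family_phi: "even_linear_family A M phi"
  unfolding even_linear_family_def linear_on_def
  using linear_phi phi_even phi_linear_in_S by blast

lemma phi_commutator_k:
  assumes x: "x \<in> lcarrier (k_alg A)" and z: "z \<in> S_space"
  shows "phi z (act x v) - act x (phi z v) = act (br z x) v"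
proof -
  obtain a b where ab: "a \<in> k0" "b \<in> g_part 1" "x = a + b"
    using x unfolding lcarrier_def k1_eq by blast
  interpret phi: Vector_Spaces.linear sc sc "phi z" by (rule linear_phi[OF z])
  have zc: "z \<in> g_part 0" using z S_subset by blast
  have carrier: "a \<in> lcarrier (g_alg A)" "b \<in> lcarrier (g_alg A)" "z \<in> lcarrier (g_alg A)"
    using ab zc k0_carrier g_part_in_carrier by blast+
  have act_x: "act x w = sc (lam a) w + act b w" for w
    using carrier ab by (simp add: act_add act_k0)
  have "br z x = br z a + br z b"
    using lie_superalgebraD(3)[OF g carrier(3)] carrier unfolding linear_on_def ab(3) by blast
  then have "br z x = br z b" using br_k0(2)[OF ab(1) zc] by simp
  then show ?thesis
    by (simp add: act_x phi.add phi.scale phi_commutator[OF z ab(2)])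
qed

lemma isomorphic_Omega: "isomorphic_modules (g_alg A) M (Omega rho phi M)"
  unfolding isomorphic_modules_def
proof (intro exI conjI)
  show "bij (\<lambda>v :: 'm. v)" by (simp add: bij_def)
  have "Vector_Spaces.linear sc sc (\<lambda>v. v)"
    by (simp add: Vector_Spaces.linear_iff vector_space_axioms)
  moreover have "\<exists>d. \<forall>p. \<forall>v\<in>mpart M p. v \<in> mpart M (p + d)"
    by (rule exI[of _ 0]) simp
  ultimately show "module_hom (g_alg A) M (Omega rho phi M) (\<lambda>v. v)"
    unfolding module_hom_def Omega_def using act_decomposition by simp
qed

end

section \<open>The classification\<close>

theorem proposition3p7:
  fixes A :: "'a::ab_group_add lie_super"
    and D :: "int \<Rightarrow> 'a set"
    and M :: "('a \<times> quad, 'm::ab_group_add) super_module"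
  assumes "abelian_lie_algebra A"
    and "Z_grading A D"
    and "simple_module (g_alg A) M"
    and "finite_dimensional M"
  shows "\<exists>(lam :: 'a \<times> quad \<Rightarrow> complex) (V :: ('a \<times> quad, 'm) super_module)
            (\<rho> :: 'a \<times> quad \<Rightarrow> complex) (\<phi> :: 'a \<times> quad \<Rightarrow> 'm \<Rightarrow> 'm).
      k0_functional A lam \<and> coradical_finite A lam \<and> is_V_c A lam V \<and>
      linear_on (lscale (g_alg A)) (*) S_space \<rho> \<and>
      even_linear_family A V \<phi> \<and>
      (\<forall>x\<in>lcarrier (k_alg A). \<forall>z\<in>S_space. \<forall>v.
         \<phi> z (mact V x v) - mact V x (\<phi> z v) = mact V (lbracket (g_alg A) z x) v) \<and>
      (\<forall>z\<in>S_space. \<forall>z'\<in>S_space. \<forall>v. \<phi> z (\<phi> z' v) - \<phi> z' (\<phi> z v) = 0) \<and>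
      isomorphic_modules (g_alg A) M (Omega \<rho> \<phi> V)"
proof -
  interpret fd_simple_module A M
    using assms by unfold_locales
  show ?thesis
  proof (intro exI conjI ballI allI)
    show "k0_functional A lam" by (rule k0_functional_lam)
    show "coradical_finite A lam" by (rule coradical_finite_lam)
    show "is_V_c A lam M" by (rule is_V_c_M)
    show "linear_on (lscale (g_alg A)) (*) S_space rho" by (rule linear_rho)
    show "even_linear_family A M phi" by (rule even_linear_family_phi)
    show "isomorphic_modules (g_alg A) M (Omega rho phi M)" by (rule isomorphic_Omega)
  qed (simp_all add: phi_commutator_k phi_commute)
qed

end
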